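(* Let $\mathcal{H}_W$ be an algebra satisfying properties ( * ) and ( ** ), let $D=\sum_{i=1}^n a_ic_i\in\mathcal H_W$, and let $d:\mathcal{H}_W\to\mathcal{H}_W$ be the linear map given on homogeneous $h$ by $d(h)=Dh-(-1)^{\deg(h)}hD$. Then for every $z\in Z(\mathcal{H}_W)_0$ there exists a unique element $\widetilde z\in Z(\mathrm{Seg}(W))_0$ such that $z-\widetilde z\in\mathrm{im}\, d$. Moreover, the map $\zeta:Z(\mathcal{H}_W)_0\to Z(\mathrm{Seg}(W))_0$, $\zeta(z)=\widetilde z$, is an algebra homomorphism.
   Context: All algebras are associative and unital over $\mathbb{C}$. For a superalgebra $\mathcal A=\mathcal A_0\oplus\mathcal A_1$, $Z(\mathcal A)$ is its (ordinary) center and $Z(\mathcal A)_0=Z(\mathcal A)\cap\mathcal A_0$. Let $W$ be a (finite) real reflection group, $V$ a representation of $W$ with a fixed $W$-invariant inner product, and $\{a_1,\dots,a_n\}$ an orthogonal basis of $V$. Property ( * ): $\mathcal H_W=\mathcal H_W(V)$ is an algebra generated by symbols $f_w$ ($w\in W$), $c_i$ and $a_i$ ($i=1,\dots,n$) such that $w\mapsto f_w$ extends to an injective algebra map $\mathbb{C}[W]\to\mathcal H_W$ (one writes $w$ for $f_w$), the elements $a_1^{k_1}\cdots a_n^{k_n}c_1^{\epsilon_1}\cdots c_n^{\epsilon_n}w$ ($k_i\in\mathbb{Z}_{\ge0}$, $\epsilon_i\in\{0,1\}$, $w\in W$) form a basis of $\mathcal H_W$, and, with $\mathrm{Seg}(W)$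 denoting the subalgebra generated by all $w\in W$ and $c_1,\dots,c_n$, the following relations hold: $wa_iw^{-1}=w(a_i)$; $[a_i,a_j]c_ic_j\in\mathrm{Seg}(W)$ for $i\ne j$; $c_ja_i=a_ic_j$ for $i\neq j$; $c_ia_i=-a_ic_i$; $c_ic_j=-c_jc_i$ for $i\ne j$ and $c_i^2=-1$; $wc_i=w(c_i)w$. Here $w(a_i)$ is the action of $w$ on $V$, and $w(c_i)$ is the action of $w$ on the span of the $c_i$ identified with $V$ via $a_i\mapsto c_i$. $\mathcal H_W$ is a superalgebra with $\deg(c_i)=1$, $\deg(a_i)=\deg(w)=0$. Homogeneous $h_1,h_2$ supercommute if $h_1h_2=(-1)^{\deg(h_1)\deg(h_2)}h_2h_1$ (extended bilinearly to all elements). Property ( ** ): for every $h\in\mathcal H_W$ which supercommutes with all elements of $\mathrm{Seg}(W)$, one has $D^2h-hD^2=0$, where $D=\sum_{i=1}^na_ic_i$. *)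

theory Defs
  imports "HOL-Analysis.Analysis" "HOL-Library.FuncSet"
begin

section \<open>Algebras and superalgebras over the complex numbers\<close>

text \<open>
  The distribution has no type class of complex algebras, so an algebra is a type of class
  \<open>ring_1\<close> together with an explicit complex scalar multiplication.
\<close>

locale complex_alg = vector_space scale
  for scale :: "complex \<Rightarrow> 'h::ring_1 \<Rightarrow> 'h" +
  assumes scale_mult_left: "scale r (x * y) = scale r x * y"
    and scale_mult_right: "scale r (x * y) = x * scale r y"

locale superalgebra = complex_alg scale
  for scale :: "complex \<Rightarrow> 'h::ring_1 \<Rightarrow> 'h" +
  fixes H0 H1 :: "'h set"
  assumes subspace_even: "subspace H0"
    and subspace_odd: "subspace H1"
    and inter: "H0 \<inter> H1 = {0}"
    and decomp: "\<exists>x\<in>H0. \<exists>y\<in>H1. h = x + y"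
    and even_even: "x \<in> H0 \<Longrightarrow> y \<in> H0 \<Longrightarrow> x * y \<in> H0"
    and even_odd: "x \<in> H0 \<Longrightarrow> y \<in> H1 \<Longrightarrow> x * y \<in> H1"
    and odd_even: "x \<in> H1 \<Longrightarrow> y \<in> H0 \<Longrightarrow> x * y \<in> H1"
    and odd_odd: "x \<in> H1 \<Longrightarrow> y \<in> H1 \<Longrightarrow> x * y \<in> H0"

inductive_set gen_subalg :: "(complex \<Rightarrow> 'h::ring_1 \<Rightarrow> 'h) \<Rightarrow> 'h set \<Rightarrow> 'h set"
  for scale :: "complex \<Rightarrow> 'h::ring_1 \<Rightarrow> 'h" and X :: "'h set" where
  gen: "x \<in> X \<Longrightarrow> x \<in> gen_subalg scale X"
| one: "1 \<in> gen_subalg scale X"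
| add: "x \<in> gen_subalg scale X \<Longrightarrow> y \<in> gen_subalg scale X \<Longrightarrow> x + y \<in> gen_subalg scale X"
| mult: "x \<in> gen_subalg scale X \<Longrightarrow> y \<in> gen_subalg scale X \<Longrightarrow> x * y \<in> gen_subalg scale X"
| scale: "x \<in> gen_subalg scale X \<Longrightarrow> scale r x \<in> gen_subalg scale X"

text \<open>The ordinary (not graded) center of a subalgebra.\<close>
definition alg_center :: "'h::ring_1 set \<Rightarrow> 'h set" where
  "alg_center B = {z \<in> B. \<forall>b\<in>B. z * b = b * z}"

definition alg_hom_on ::
  "(complex \<Rightarrow> 'h::ring_1 \<Rightarrow> 'h) \<Rightarrow> 'h set \<Rightarrow> 'h set \<Rightarrow> ('h \<Rightarrow> 'h) \<Rightarrow> bool" where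
  "alg_hom_on sH A B \<phi> \<longleftrightarrow>
     \<phi> ` A \<subseteq> B \<and>
     (\<forall>x\<in>A. \<forall>y\<in>A. \<phi> (x + y) = \<phi> x + \<phi> y) \<and>
     (\<forall>r. \<forall>x\<in>A. \<phi> (sH r x) = sH r (\<phi> x)) \<and>
     (\<forall>x\<in>A. \<forall>y\<in>A. \<phi> (x * y) = \<phi> x * \<phi> y) \<and>
     \<phi> 1 = 1"

definition even_part :: "'h::ring_1 set \<Rightarrow> 'h set \<Rightarrow> 'h \<Rightarrow> 'h" where
  "even_part H0 H1 h = (THE x. x \<in> H0 \<and> h - x \<in> H1)"

definition odd_part :: "'h::ring_1 set \<Rightarrow> 'h set \<Rightarrow> 'h \<Rightarrow> 'h" where
  "odd_part H0 H1 h = h - even_part H0 H1 h"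

text \<open>
  The bilinear extension of
  $[x,y] = xy - (-1)^{\deg(x)\deg(y)}yx$.
\<close>
definition supercommutator :: "'h::ring_1 set \<Rightarrow> 'h set \<Rightarrow> 'h \<Rightarrow> 'h \<Rightarrow> 'h" where
  "supercommutator H0 H1 x y =
     (let x0 = even_part H0 H1 x; x1 = odd_part H0 H1 x;
          y0 = even_part H0 H1 y; y1 = odd_part H0 H1 y
      in (x0 * y0 - y0 * x0) + (x0 * y1 - y1 * x0) + (x1 * y0 - y0 * x1) + (x1 * y1 + y1 * x1))"

definition supercommute :: "'h::ring_1 set \<Rightarrow> 'h set \<Rightarrow> 'h \<Rightarrow> 'h \<Rightarrow> bool" where
  "supercommute H0 H1 x y \<longleftrightarrow> supercommutator H0 H1 x y = 0"


section \<open>Finite real reflection groups and their representations\<close>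

definition hyperplane_reflection :: "'e::euclidean_space \<Rightarrow> 'e \<Rightarrow> 'e" where
  "hyperplane_reflection \<alpha> x = x - (2 * (x \<bullet> \<alpha>) / (\<alpha> \<bullet> \<alpha>)) *\<^sub>R \<alpha>"

text \<open>
  A finite set of maps, with composition as multiplication, generated by reflections. Reflections
  are involutions, so the group they generate consists of the finite products of reflections.
\<close>
definition finite_reflection_group :: "('e::euclidean_space \<Rightarrow> 'e) set \<Rightarrow> bool" where
  "finite_reflection_group W \<longleftrightarrow>
     finite W \<and>
     (\<exists>R. 0 \<notin> R \<and> W = {foldr (\<circ>) (map hyperplane_reflection \<alpha>s) id |\<alpha>s. set \<alpha>s \<subseteq> R})"

text \<open>
  A complex representation with an invariant Hermitian inner product (linear in the first
  argument). This includes real representations with an invariant real inner product: after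
  complexification an orthogonal basis stays an orthogonal basis, and the group elements keep
  their matrices, which are all that enters the relations below.
\<close>
locale unitary_rep = vector_space scale
  for scale :: "complex \<Rightarrow> 'v::ab_group_add \<Rightarrow> 'v" +
  fixes W :: "('e \<Rightarrow> 'e) set"
    and \<rho> :: "('e \<Rightarrow> 'e) \<Rightarrow> 'v \<Rightarrow> 'v"
    and ip :: "'v \<Rightarrow> 'v \<Rightarrow> complex"
  assumes rep_linear: "w \<in> W \<Longrightarrow> Vector_Spaces.linear scale scale (\<rho> w)"
    and rep_id: "\<rho> id = id"
    and rep_comp: "w \<in> W \<Longrightarrow> w' \<in> W \<Longrightarrow> \<rho> (w \<circ> w') = \<rho> w \<circ> \<rho> w'"
    and ip_add: "ip (u + v) x = ip u x + ip v x"
    and ip_scale: "ip (scale r u) x = r * ip u x"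
    and ip_cnj: "ip x u = cnj (ip u x)"
    and ip_pos: "u \<noteq> 0 \<Longrightarrow> Re (ip u u) > 0"
    and ip_invariant: "w \<in> W \<Longrightarrow> ip (\<rho> w u) (\<rho> w v) = ip u v"


section \<open>The algebras under consideration\<close>

text \<open>
  The linear map from \<open>V\<close> sending the basis vector \<open>bs i\<close> to \<open>x i\<close>. It gives a meaning inside the
  algebra to \<open>w(a\<^sub>i)\<close> (take \<open>x = a\<close>) and to \<open>w(c\<^sub>i)\<close> (take \<open>x = c\<close>).
\<close>
definition lin_ext ::
  "(complex \<Rightarrow> 'v::ab_group_add \<Rightarrow> 'v) \<Rightarrow> (complex \<Rightarrow> 'h::ring_1 \<Rightarrow> 'h) \<Rightarrow> nat \<Rightarrow>
   (nat \<Rightarrow> 'v) \<Rightarrow> (nat \<Rightarrow> 'h) \<Rightarrow> 'v \<Rightarrow> 'h" where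
  "lin_ext sV sH n bs x v =
     (\<Sum>i=1..n. sH (module.representation sV (bs ` {1..n}) v (bs i)) (x i))"

definition Seg ::
  "(complex \<Rightarrow> 'h::ring_1 \<Rightarrow> 'h) \<Rightarrow> 'g set \<Rightarrow> nat \<Rightarrow> ('g \<Rightarrow> 'h) \<Rightarrow> (nat \<Rightarrow> 'h) \<Rightarrow> 'h set" where
  "Seg sH W n f c = gen_subalg sH (f ` W \<union> c ` {1..n})"

definition pbw_index :: "'g set \<Rightarrow> nat \<Rightarrow> ((nat \<Rightarrow> nat) \<times> (nat \<Rightarrow> nat) \<times> 'g) set" where
  "pbw_index W n = ({1..n} \<rightarrow>\<^sub>E UNIV) \<times> ({1..n} \<rightarrow>\<^sub>E {0, 1}) \<times> W"

definition pbw_monomial ::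
  "nat \<Rightarrow> ('g \<Rightarrow> 'h::ring_1) \<Rightarrow> (nat \<Rightarrow> 'h) \<Rightarrow> (nat \<Rightarrow> 'h) \<Rightarrow>
   (nat \<Rightarrow> nat) \<times> (nat \<Rightarrow> nat) \<times> 'g \<Rightarrow> 'h" where
  "pbw_monomial n f c a = (\<lambda>(k, \<epsilon>, w).
     prod_list (map (\<lambda>i. a i ^ k i) [1..<Suc n]) *
     prod_list (map (\<lambda>i. c i ^ \<epsilon> i) [1..<Suc n]) * f w)"

text \<open>
  The parameter \<open>bs\<close> is the orthogonal basis of \<open>V\<close>, whose \<open>i\<close>-th member corresponds to the
  generator \<open>a i\<close>; \<open>f w\<close> is the image of the group element \<open>w\<close>. The assumptions \<open>f_id\<close>,
  \<open>f_comp\<close> and \<open>f_inj\<close> say that \<open>f\<close> extends to an injective algebra map on the group algebra,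
  whose elements are given by their coefficient functions on \<open>W\<close>.
\<close>
locale hecke_clifford =
  V: unitary_rep sV W \<rho> ip + H: superalgebra sH H0 H1
  for W :: "('e::euclidean_space \<Rightarrow> 'e) set"
    and sV :: "complex \<Rightarrow> 'v::ab_group_add \<Rightarrow> 'v"
    and \<rho> :: "('e \<Rightarrow> 'e) \<Rightarrow> 'v \<Rightarrow> 'v"
    and ip :: "'v \<Rightarrow> 'v \<Rightarrow> complex"
    and sH :: "complex \<Rightarrow> 'h::ring_1 \<Rightarrow> 'h"
    and H0 H1 :: "'h set" +
  fixes n :: nat
    and bs :: "nat \<Rightarrow> 'v"
    and f :: "('e \<Rightarrow> 'e) \<Rightarrow> 'h"
    and c a :: "nat \<Rightarrow> 'h"
  assumes reflection_group: "finite_reflection_group W"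
    and bs_inj: "inj_on bs {1..n}"
    and bs_independent: "V.independent (bs ` {1..n})"
    and bs_span: "V.span (bs ` {1..n}) = UNIV"
    and bs_orthogonal:
      "i \<in> {1..n} \<Longrightarrow> j \<in> {1..n} \<Longrightarrow> i \<noteq> j \<Longrightarrow> ip (bs i) (bs j) = 0"
    and generated: "gen_subalg sH (f ` W \<union> c ` {1..n} \<union> a ` {1..n}) = UNIV"
    and f_id: "f id = 1"
    and f_comp: "w \<in> W \<Longrightarrow> w' \<in> W \<Longrightarrow> f (w \<circ> w') = f w * f w'"
    and f_inj: "inj_on (\<lambda>x. \<Sum>w\<in>W. sH (x w) (f w)) (W \<rightarrow>\<^sub>E UNIV)"
    and pbw_inj: "inj_on (pbw_monomial n f c a) (pbw_index W n)"
    and pbw_independent: "H.independent (pbw_monomial n f c a ` pbw_index W n)"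
    and pbw_span: "H.span (pbw_monomial n f c a ` pbw_index W n) = UNIV"
    and rel_w_a: "w \<in> W \<Longrightarrow> i \<in> {1..n} \<Longrightarrow>
      f w * a i * f (inv w) = lin_ext sV sH n bs a (\<rho> w (bs i))"
    and rel_a_a: "i \<in> {1..n} \<Longrightarrow> j \<in> {1..n} \<Longrightarrow> i \<noteq> j \<Longrightarrow>
      (a i * a j - a j * a i) * c i * c j \<in> Seg sH W n f c"
    and rel_c_a: "i \<in> {1..n} \<Longrightarrow> j \<in> {1..n} \<Longrightarrow> i \<noteq> j \<Longrightarrow> c j * a i = a i * c j"
    and rel_c_a_same: "i \<in> {1..n} \<Longrightarrow> c i * a i = - (a i * c i)"
    and rel_c_c: "i \<in> {1..n} \<Longrightarrow> j \<in> {1..n} \<Longrightarrow> i \<noteq> j \<Longrightarrow> c i * c j = - (c j * c i)"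
    and rel_c_sq: "i \<in> {1..n} \<Longrightarrow> c i ^ 2 = -1"
    and rel_w_c: "w \<in> W \<Longrightarrow> i \<in> {1..n} \<Longrightarrow>
      f w * c i = lin_ext sV sH n bs c (\<rho> w (bs i)) * f w"
    and deg_c: "i \<in> {1..n} \<Longrightarrow> c i \<in> H1"
    and deg_a: "i \<in> {1..n} \<Longrightarrow> a i \<in> H0"
    and deg_w: "w \<in> W \<Longrightarrow> f w \<in> H0"

definition dirac_element :: "nat \<Rightarrow> (nat \<Rightarrow> 'h::ring_1) \<Rightarrow> (nat \<Rightarrow> 'h) \<Rightarrow> 'h" where
  "dirac_element n c a = (\<Sum>i=1..n. a i * c i)"

text \<open>The linear extension of $h \mapsto Dh - (-1)^{\deg(h)}hD$.\<close>
definition dirac_derivation :: "'h::ring_1 set \<Rightarrow> 'h set \<Rightarrow> 'h \<Rightarrow> 'h \<Rightarrow> 'h" where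
  "dirac_derivation H0 H1 D h =
     (let h0 = even_part H0 H1 h; h1 = odd_part H0 H1 h
      in (D * h0 - h0 * D) + (D * h1 + h1 * D))"

end

theory Submission
  imports Defs
begin

text \<open>
  Write \<open>K\<close> for the supercentralizer of \<open>Seg(W)\<close>. Since \<open>D\<close> supercommutes with \<open>Seg(W)\<close>, the odd
  derivation \<open>d\<close> kills \<open>Seg(W)\<close>, and property (**) says that \<open>d\<^sup>2 = 0\<close> on \<open>K\<close>. Filter the algebra by
  the degree in the \<open>a\<^sub>i\<close>. The commutators \<open>[a\<^sub>i, a\<^sub>j]\<close> lie in \<open>Seg(W)\<close>, so on the associated graded
  space \<open>d\<close> becomes a tensor product of the one-variable complexes
  \<open>a\<^sub>i\<^sup>k \<mapsto> ((-1)\<^sup>k - 1) a\<^sub>i\<^sup>k\<^sup>+\<^sup>1 c\<^sub>i\<close>, whose cohomology is \<open>Seg(W)\<close>, by an explicit contraction.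
  Averaging over the finite group generated by \<open>W\<close> and the \<open>c\<^sub>i\<close> projects onto \<open>K\<close> and commutes with
  \<open>d\<close>, so induction on the filtration degree shows that every cocycle in \<open>K\<close> is an element of
  \<open>Seg(W) \<inter> K\<close> plus a coboundary, and that \<open>Seg(W) \<inter> K\<close> contains no nonzero coboundary.
  Multiplicativity of \<open>\<zeta>\<close> then follows from the Leibniz rule.
\<close>

section \<open>Superalgebras and reflection groups\<close>

context superalgebra
begin

lemma even_part_eqI:
  assumes "x \<in> H0" "h - x \<in> H1"
  shows "even_part H0 H1 h = x"
  unfolding even_part_def
proof (rule the_equality)
  fix y assume y: "y \<in> H0 \<and> h - y \<in> H1"
  have "y - x \<in> H0" using y assms subspace_even subspace_diff by blast
  moreover have "(h - x) - (h - y) \<in> H1" using y assms subspace_odd subspace_diff by blast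
  ultimately have "y - x \<in> H0 \<inter> H1" by simp
  then show "y = x" using inter by simp
qed (use assms in simp)

lemma even_part_add: "x \<in> H0 \<Longrightarrow> y \<in> H1 \<Longrightarrow> even_part H0 H1 (x + y) = x"
  by (rule even_part_eqI) auto

lemma odd_part_add: "x \<in> H0 \<Longrightarrow> y \<in> H1 \<Longrightarrow> odd_part H0 H1 (x + y) = y"
  by (simp add: odd_part_def even_part_add)

text \<open>The grading automorphism, 1 on \<open>H0\<close> and -1 on \<open>H1\<close>. Expressing
  the sign \<open>(-1)^deg(h)\<close> through it makes all later formulas valid for inhomogeneous
  elements.\<close>

definition parity :: "'h \<Rightarrow> 'h" where
  "parity h = even_part H0 H1 h - odd_part H0 H1 h"

lemma parity_decomp: "x \<in> H0 \<Longrightarrow> y \<in> H1 \<Longrightarrow> parity (x + y) = x - y"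
  by (simp add: parity_def even_part_add odd_part_add)

lemma homogeneous_cases:
  obtains x y where "x \<in> H0" "y \<in> H1" "h = x + y" "parity h = x - y"
    "even_part H0 H1 h = x" "odd_part H0 H1 h = y"
  using decomp[of h] parity_decomp even_part_add odd_part_add by metis

lemma parity_even: "x \<in> H0 \<Longrightarrow> parity x = x"
  using parity_decomp[of x 0] subspace_0[OF subspace_odd] by simp

lemma parity_odd: "x \<in> H1 \<Longrightarrow> parity x = - x"
  using parity_decomp[of 0 x] subspace_0[OF subspace_even] by simp

lemma parity_add: "parity (g + h) = parity g + parity h"
proof -
  obtain x y where g: "x \<in> H0" "y \<in> H1" "g = x + y" "parity g = x - y" by (rule homogeneous_cases)
  obtain u v where h: "u \<in> H0" "v \<in> H1" "h = u + v" "parity h = u - v" by (rule homogeneous_cases)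
  have "parity ((x + u) + (y + v)) = (x + u) - (y + v)"
    using g h by (intro parity_decomp) (auto intro: subspace_add subspace_even subspace_odd)
  moreover have "(x + u) + (y + v) = g + h" using g(3) h(3) by (simp add: algebra_simps)
  ultimately show ?thesis unfolding g(4) h(4) by (simp add: algebra_simps)
qed

lemma parity_scale: "parity (scale r h) = scale r (parity h)"
proof -
  obtain x y where h: "x \<in> H0" "y \<in> H1" "h = x + y" "parity h = x - y" by (rule homogeneous_cases)
  have "parity (scale r x + scale r y) = scale r x - scale r y"
    using h by (intro parity_decomp) (auto intro: subspace_scale subspace_even subspace_odd)
  then show ?thesis using h by (simp add: scale_right_distrib scale_right_diff_distrib)
qed

lemma parity_mult: "parity (g * h) = parity g * parity h"
proof -
  obtain x y where g: "x \<in> H0" "y \<in> H1" "g = x + y" "parity g = x - y" by (rule homogeneous_cases)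
  obtain u v where h: "u \<in> H0" "v \<in> H1" "h = u + v" "parity h = u - v" by (rule homogeneous_cases)
  have "parity ((x * u + y * v) + (x * v + y * u)) = (x * u + y * v) - (x * v + y * u)"
    using g h by (intro parity_decomp)
      (auto intro: subspace_add subspace_even subspace_odd even_even even_odd odd_even odd_odd)
  moreover have "(x * u + y * v) + (x * v + y * u) = g * h" using g(3) h(3) by (simp add: algebra_simps)
  ultimately show ?thesis unfolding g(4) h(4) by (simp add: algebra_simps)
qed

lemma parity_parity [simp]: "parity (parity h) = h"
proof -
  obtain x y where h: "x \<in> H0" "y \<in> H1" "h = x + y" "parity h = x - y" by (rule homogeneous_cases)
  have "parity (x + - y) = x - - y"
    using h by (intro parity_decomp) (auto intro: subspace_neg subspace_odd)
  then show ?thesis using h by simp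
qed

lemma parity_zero [simp]: "parity 0 = 0"
  using parity_add[of 0 0] by simp

lemma parity_uminus: "parity (- h) = - parity h"
  using parity_add[of h "- h"] by (simp add: eq_neg_iff_add_eq_0 add.commute)

lemma parity_diff: "parity (g - h) = parity g - parity h"
  using parity_add[of g "- h"] by (simp add: parity_uminus)

lemma parity_sum: "parity (sum g A) = (\<Sum>x\<in>A. parity (g x))"
  by (induction A rule: infinite_finite_induct) (auto simp: parity_add)

text \<open>\<open>parity\<close> is multiplicative and onto, so \<open>parity 1\<close> is again a
  unit element.\<close>

lemma parity_one [simp]: "parity 1 = 1"
  using parity_mult[of 1 "parity 1"] by simp

lemma even_iff: "h \<in> H0 \<longleftrightarrow> parity h = h"
proof
  assume p: "parity h = h"
  obtain x y where h: "x \<in> H0" "y \<in> H1" "h = x + y" "parity h = x - y" by (rule homogeneous_cases)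
  have "y + y = 0" using p h by (simp add: algebra_simps)
  then have "scale 2 y = 0" by (simp only: one_add_one[symmetric] scale_left_distrib scale_one)
  then have "y = 0" by simp
  then show "h \<in> H0" using h by simp
qed (rule parity_even)

text \<open>The four terms of the supercommutator are grouped by the homogeneous part of
  \<open>x\<close>; the signs met by the odd part are absorbed into \<open>parity y\<close>.\<close>

lemma supercommuteI:
  assumes even: "even_part H0 H1 x * y = y * even_part H0 H1 x"
    and odd: "odd_part H0 H1 x * y = parity y * odd_part H0 H1 x"
  shows "supercommute H0 H1 x y"
proof -
  obtain u v where y: "y = u + v" "parity y = u - v" "even_part H0 H1 y = u" "odd_part H0 H1 y = v"
    by (rule homogeneous_cases)
  show ?thesis
    using even odd unfolding y(2) supercommute_def supercommutator_def Let_def y(3,4)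
    unfolding y(1) by (simp add: algebra_simps)
qed

end

definition super_derivation :: "('h::ring_1 \<Rightarrow> 'h) \<Rightarrow> 'h \<Rightarrow> 'h \<Rightarrow> 'h" where
  "super_derivation p D h = D * h - p h * D"

lemma (in superalgebra) dirac_derivation_eq:
  "dirac_derivation H0 H1 D = super_derivation parity D"
proof
  fix h
  obtain x y where h: "h = x + y" "parity h = x - y" "even_part H0 H1 h = x" "odd_part H0 H1 h = y"
    by (rule homogeneous_cases)
  show "dirac_derivation H0 H1 D h = super_derivation parity D h"
    unfolding dirac_derivation_def super_derivation_def Let_def h(3,4) h(2) unfolding h(1)
    by (simp add: algebra_simps)
qed

section \<open>Products of spans\<close>

context complex_alg
begin

lemma subspace_gen_subalg: "subspace (gen_subalg scale X)"
proof (rule subspaceI)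
  show "0 \<in> gen_subalg scale X"
  proof -
    have "scale 0 1 \<in> gen_subalg scale X" by (intro gen_subalg.intros)
    then show ?thesis by simp
  qed
qed (auto intro: gen_subalg.intros)

text \<open>Bilinearity reduces closure under products to spanning sets. A fixed factor is treated
  below as a singleton spanning set.\<close>

lemma span_mult_subset:
  assumes "\<And>x y. x \<in> X \<Longrightarrow> y \<in> Y \<Longrightarrow> x * y \<in> span Z" "g \<in> span X" "h \<in> span Y"
  shows "g * h \<in> span Z"
proof -
  have *: "x * h \<in> span Z" if x: "x \<in> X" for x
    using \<open>h \<in> span Y\<close>
  proof (induction rule: span_induct_alt)
    case (step r y z)
    then show ?case using assms(1)[OF x]
      by (auto simp: distrib_left scale_mult_right[symmetric] intro: span_add span_scale)
  qed (simp add: span_zero)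
  show ?thesis using \<open>g \<in> span X\<close>
  proof (induction rule: span_induct_alt)
    case (step r x z)
    then show ?case using *
      by (auto simp: distrib_right scale_mult_left[symmetric] intro: span_add span_scale)
  qed (simp add: span_zero)
qed

lemma sum_scale_mult: "(\<Sum>i\<in>A. scale (r i) (x i)) * y = (\<Sum>i\<in>A. scale (r i) (x i * y))"
  by (simp add: sum_distrib_right scale_mult_left)

lemma mult_sum_scale: "y * (\<Sum>i\<in>A. scale (r i) (x i)) = (\<Sum>i\<in>A. scale (r i) (y * x i))"
  by (simp add: sum_distrib_left scale_mult_right)

end

section \<open>Finite reflection groups\<close>

lemma reflection_reflection:
  "\<alpha> \<noteq> 0 \<Longrightarrow> hyperplane_reflection \<alpha> (hyperplane_reflection \<alpha> x) = x"
  by (simp add: hyperplane_reflection_def inner_diff_left field_simps)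

text \<open>Reflections are involutions, so the reversed word represents the inverse.\<close>

lemma finite_reflection_group_group:
  assumes "finite_reflection_group W"
  shows "finite W" "id \<in> W" "\<And>v w. v \<in> W \<Longrightarrow> w \<in> W \<Longrightarrow> v \<circ> w \<in> W"
    "\<And>w. w \<in> W \<Longrightarrow> inv w \<in> W" "\<And>w. w \<in> W \<Longrightarrow> bij w"
proof -
  obtain R where fin: "finite W" and R: "0 \<notin> R"
    "W = {foldr (\<circ>) (map hyperplane_reflection \<alpha>s) id |\<alpha>s. set \<alpha>s \<subseteq> R}"
    using assms unfolding finite_reflection_group_def by blast
  define F where "F \<alpha>s = foldr (\<circ>) (map hyperplane_reflection \<alpha>s) id" for \<alpha>s :: "'a list"
  have W: "w \<in> W \<longleftrightarrow> (\<exists>\<alpha>s. set \<alpha>s \<subseteq> R \<and> w = F \<alpha>s)" for w unfolding R(2) F_def by blast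
  have F_append: "F (\<alpha>s @ \<beta>s) = F \<alpha>s \<circ> F \<beta>s" for \<alpha>s \<beta>s
    by (induction \<alpha>s) (auto simp: F_def comp_assoc)
  have F_rev: "F \<alpha>s \<circ> F (rev \<alpha>s) = id" if "set \<alpha>s \<subseteq> R" for \<alpha>s
    using that
  proof (induction \<alpha>s)
    case (Cons \<alpha> \<alpha>s)
    then have "\<alpha> \<noteq> 0" using R(1) by auto
    have "F (\<alpha> # \<alpha>s) \<circ> F (rev (\<alpha> # \<alpha>s))
        = hyperplane_reflection \<alpha> \<circ> (F \<alpha>s \<circ> F (rev \<alpha>s)) \<circ> hyperplane_reflection \<alpha>"
      by (simp add: F_append) (simp add: F_def comp_assoc)
    also have "\<dots> = id" using Cons reflection_reflection[OF \<open>\<alpha> \<noteq> 0\<close>] by (auto simp: fun_eq_iff)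
    finally show ?case .
  qed (simp add: F_def)
  show "finite W" by (rule fin)
  show "id \<in> W" unfolding W by (rule exI[of _ "[]"]) (simp add: F_def)
  show "v \<circ> w \<in> W" if "v \<in> W" "w \<in> W" for v w
    using that F_append unfolding W by (metis Un_subset_iff set_append)
  have *: "\<exists>v\<in>W. w \<circ> v = id \<and> v \<circ> w = id" if w: "w \<in> W" for w
  proof -
    obtain \<alpha>s where \<alpha>s: "set \<alpha>s \<subseteq> R" "w = F \<alpha>s" using w W by blast
    have "F (rev \<alpha>s) \<in> W" using \<alpha>s(1) W[of "F (rev \<alpha>s)"] by (metis set_rev)
    then show ?thesis using F_rev[of \<alpha>s] F_rev[of "rev \<alpha>s"] \<alpha>s by auto
  qed
  show "inv w \<in> W" if "w \<in> W" for w using *[OF that] inv_unique_comp by metis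
  show "bij w" if "w \<in> W" for w using *[OF that] o_bij by metis
qed

section \<open>The Dirac element and the algebra Seg(W)\<close>

context hecke_clifford
begin

abbreviation dirac :: 'h where "dirac \<equiv> dirac_element n c a"
abbreviation seg :: "'h set" where "seg \<equiv> Seg sH W n f c"
abbreviation dd :: "'h \<Rightarrow> 'h" where "dd \<equiv> super_derivation H.parity dirac"

lemmas W_group = finite_reflection_group_group[OF reflection_group]

lemma f_inv: "w \<in> W \<Longrightarrow> f w * f (inv w) = 1" "w \<in> W \<Longrightarrow> f (inv w) * f w = 1"
  using f_comp[of w "inv w"] f_comp[of "inv w" w] f_id W_group(4,5)[of w]
    surj_iff[of w] inj_iff[of w] by (simp_all add: bij_is_inj bij_is_surj)

lemma f_inv_cancel: "w \<in> W \<Longrightarrow> f w * (f (inv w) * x) = x" "w \<in> W \<Longrightarrow> f (inv w) * (f w * x) = x"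
  using f_inv[of w] by (simp_all add: mult.assoc[symmetric])

lemma inv_inv_W: "w \<in> W \<Longrightarrow> inv (inv w) = w"
  using W_group(5) inv_inv_eq by blast

definition rep_coeff :: "('e \<Rightarrow> 'e) \<Rightarrow> nat \<Rightarrow> nat \<Rightarrow> complex" where
  "rep_coeff w i j = module.representation sV (bs ` {1..n}) (\<rho> w (bs i)) (bs j)"

lemma conj_a: "w \<in> W \<Longrightarrow> i \<in> {1..n} \<Longrightarrow>
    f w * a i * f (inv w) = (\<Sum>j=1..n. sH (rep_coeff w i j) (a j))"
  by (simp add: rel_w_a lin_ext_def rep_coeff_def)

lemma conj_c: "w \<in> W \<Longrightarrow> i \<in> {1..n} \<Longrightarrow>
    f w * c i * f (inv w) = (\<Sum>j=1..n. sH (rep_coeff w i j) (c j))"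
  by (simp add: rel_w_c lin_ext_def rep_coeff_def mult.assoc f_inv)

lemma c_sq: "i \<in> {1..n} \<Longrightarrow> c i * c i = -1"
  using rel_c_sq by (simp add: power2_eq_square)

lemma c_sq_left: "i \<in> {1..n} \<Longrightarrow> c i * (c i * x) = - x"
  using c_sq[of i] by (simp add: mult.assoc[symmetric])

lemma c_anticommute:
  assumes "i \<in> {1..n}" "j \<in> {1..n}"
  shows "c i * c j + c j * c i = sH (if i = j then -2 else 0) 1"
proof (cases "i = j")
  case True
  have "sH (-2) 1 = - (1 + 1)"
    by (simp only: H.scale_minus_left one_add_one[symmetric] H.scale_left_distrib H.scale_one)
  then show ?thesis using True c_sq[OF assms(1)] by simp
qed (use rel_c_c[OF assms] in simp)

text \<open>Anticommuting with \<open>c j\<close> reads off the j-th coordinate of a vector in the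
  span of the \<open>c k\<close>.\<close>

lemma c_anticommute_sum:
  assumes "j \<in> {1..n}"
  shows "c j * (\<Sum>k=1..n. sH (r k) (c k)) + (\<Sum>k=1..n. sH (r k) (c k)) * c j = sH (-2 * r j) 1"
proof -
  have "c j * (\<Sum>k=1..n. sH (r k) (c k)) + (\<Sum>k=1..n. sH (r k) (c k)) * c j
      = (\<Sum>k=1..n. sH (r k) (c j * c k + c k * c j))"
    by (simp add: H.sum_scale_mult H.mult_sum_scale H.scale_right_distrib sum.distrib)
  also have "\<dots> = (\<Sum>k=1..n. if k = j then sH (-2 * r j) 1 else 0)"
    using assms by (intro sum.cong) (auto simp: c_anticommute mult.commute)
  finally show ?thesis using assms by simp
qed

text \<open>
  The relations \<open>c i ^ 2 = -1\<close> and \<open>c i * c j = - c j * c i\<close> are preserved by conjugation with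
  \<open>f w\<close>, so \<open>W\<close> acts by complex orthogonal matrices, even though the basis \<open>bs\<close> is not assumed
  to be normalized.
\<close>
lemma rep_coeff_inv:
  assumes w: "w \<in> W" and i: "i \<in> {1..n}" and j: "j \<in> {1..n}"
  shows "rep_coeff (inv w) j i = rep_coeff w i j"
proof -
  define x where "x = f w * c i * f (inv w)"
  define y where "y = f (inv w) * c j * f w"
  \<comment> \<open>The anticommutator of \<open>c j\<close> and \<open>x\<close> is a scalar, hence
    fixed by conjugation with \<open>f (inv w)\<close>, which turns it into the anticommutator of
    \<open>y\<close> and \<open>c i\<close>.\<close>
  have "sH (-2 * rep_coeff w i j) 1 = c j * x + x * c j"
    unfolding x_def conj_c[OF w i] c_anticommute_sum[OF j] ..
  then have "f (inv w) * sH (-2 * rep_coeff w i j) 1 * f w = f (inv w) * (c j * x + x * c j) * f w"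
    by simp
  also have "\<dots> = c i * y + y * c i"
    unfolding x_def y_def
    by (simp add: algebra_simps f_inv f_inv_cancel w)
  also have "\<dots> = sH (-2 * rep_coeff (inv w) j i) 1"
    using conj_c[OF W_group(4)[OF w] j] unfolding inv_inv_W[OF w] y_def[symmetric]
    by (simp only: c_anticommute_sum[OF i])
  finally have "sH (-2 * rep_coeff w i j) (f (inv w) * f w) = sH (-2 * rep_coeff (inv w) j i) 1"
    by (simp only: H.scale_mult_left[symmetric] H.scale_mult_right[symmetric] mult_1_right)
  then show ?thesis unfolding f_inv(2)[OF w] H.scale_cancel_right by simp
qed

text \<open>Conjugation by \<open>w\<close> applies the same matrix to the \<open>a i\<close> and to
  the \<open>c i\<close>, and \<open>D\<close> is the invariant tensor: orthogonality, in the form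
  \<open>rep_coeff_inv\<close>, collapses the double sum.\<close>

lemma f_dirac:
  assumes w: "w \<in> W"
  shows "f w * dirac = dirac * f w"
proof -
  have "f w * dirac * f (inv w) = (\<Sum>i=1..n. (f w * a i * f (inv w)) * (f w * c i * f (inv w)))"
    by (simp add: dirac_element_def sum_distrib_left sum_distrib_right mult.assoc f_inv_cancel w)
  also have "\<dots> = (\<Sum>i=1..n. \<Sum>j=1..n. a j * (f w * sH (rep_coeff w i j) (c i) * f (inv w)))"
    by (intro sum.cong refl)
      (simp only: conj_a[OF w] H.sum_scale_mult H.scale_mult_left[symmetric]
        H.scale_mult_right[symmetric])
  also have "\<dots> = (\<Sum>j=1..n. \<Sum>i=1..n. a j * (f w * sH (rep_coeff w i j) (c i) * f (inv w)))"
    by (rule sum.swap)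
  also have "\<dots> = (\<Sum>j=1..n. a j * c j)"
  proof (intro sum.cong refl)
    fix j assume j: "j \<in> {1..n}"
    \<comment> \<open>The column sum of the matrix of \<open>w\<close> is a row sum for
      \<open>inv w\<close>, that is, a conjugate of \<open>c j\<close> which the outer conjugation
      undoes.\<close>
    have "(\<Sum>i=1..n. sH (rep_coeff w i j) (c i)) = (\<Sum>i=1..n. sH (rep_coeff (inv w) j i) (c i))"
      by (intro sum.cong refl) (simp only: rep_coeff_inv[OF w _ j])
    also have "\<dots> = f (inv w) * c j * f w"
      using conj_c[OF W_group(4)[OF w] j] inv_inv_W[OF w] by simp
    finally have "(\<Sum>i=1..n. a j * (f w * sH (rep_coeff w i j) (c i) * f (inv w)))
        = a j * (f w * (f (inv w) * c j * f w) * f (inv w))"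
      by (simp only: sum_distrib_left[symmetric] sum_distrib_right[symmetric])
    then show "(\<Sum>i=1..n. a j * (f w * sH (rep_coeff w i j) (c i) * f (inv w))) = a j * c j"
      by (simp add: mult.assoc f_inv f_inv_cancel w)
  qed
  finally have "f w * dirac * f (inv w) * f w = dirac * f w" by (simp add: dirac_element_def)
  then show ?thesis by (simp add: mult.assoc f_inv w)
qed

text \<open>Each summand \<open>a i * c i\<close> contributes exactly one sign: from passing
  \<open>a i\<close> if \<open>i = j\<close>, from passing \<open>c i\<close> otherwise.\<close>

lemma c_dirac:
  assumes j: "j \<in> {1..n}"
  shows "c j * dirac = - (dirac * c j)"
proof -
  have "c j * (a i * c i) = - (a i * c i * c j)" if i: "i \<in> {1..n}" for i
  proof (cases "i = j")
    case True
    then show ?thesis using rel_c_a_same[OF i] by (simp add: mult.assoc[symmetric])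
  next
    case False
    have "c j * (a i * c i) = a i * (c j * c i)"
      using rel_c_a[OF i j False] by (simp add: mult.assoc[symmetric])
    then show ?thesis using rel_c_c[OF i j False] by (simp add: mult.assoc)
  qed
  then show ?thesis
    by (simp add: dirac_element_def sum_distrib_left sum_distrib_right sum_negf[symmetric])
qed

lemma parity_c: "i \<in> {1..n} \<Longrightarrow> H.parity (c i) = - c i"
  by (simp add: H.parity_odd deg_c)

lemma parity_f: "w \<in> W \<Longrightarrow> H.parity (f w) = f w"
  by (simp add: H.parity_even deg_w)

lemma parity_a: "i \<in> {1..n} \<Longrightarrow> H.parity (a i) = a i"
  by (simp add: H.parity_even deg_a)

lemma parity_dirac: "H.parity dirac = - dirac"
  by (simp add: dirac_element_def H.parity_sum H.parity_mult parity_c parity_a sum_negf)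

lemma subspace_seg: "H.subspace seg"
  unfolding Seg_def by (rule H.subspace_gen_subalg)

lemma seg_intros:
  "1 \<in> seg" "w \<in> W \<Longrightarrow> f w \<in> seg" "i \<in> {1..n} \<Longrightarrow> c i \<in> seg"
  "s \<in> seg \<Longrightarrow> t \<in> seg \<Longrightarrow> s * t \<in> seg" "s \<in> seg \<Longrightarrow> t \<in> seg \<Longrightarrow> s + t \<in> seg"
  "s \<in> seg \<Longrightarrow> t \<in> seg \<Longrightarrow> s - t \<in> seg" "s \<in> seg \<Longrightarrow> - s \<in> seg" "s \<in> seg \<Longrightarrow> sH r s \<in> seg" "0 \<in> seg"
  using H.subspace_diff[OF subspace_seg] H.subspace_neg[OF subspace_seg] H.subspace_0[OF subspace_seg]
  by (auto simp: Seg_def intro: gen_subalg.intros)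

lemma seg_induct [consumes 1, case_names f c one add mult scale]:
  assumes "s \<in> seg" "\<And>w. w \<in> W \<Longrightarrow> P (f w)" "\<And>i. i \<in> {1..n} \<Longrightarrow> P (c i)" "P 1"
    "\<And>s t. s \<in> seg \<Longrightarrow> t \<in> seg \<Longrightarrow> P s \<Longrightarrow> P t \<Longrightarrow> P (s + t)"
    "\<And>s t. s \<in> seg \<Longrightarrow> t \<in> seg \<Longrightarrow> P s \<Longrightarrow> P t \<Longrightarrow> P (s * t)"
    "\<And>r s. s \<in> seg \<Longrightarrow> P s \<Longrightarrow> P (sH r s)"
  shows "P s"
  using assms(1) unfolding Seg_def
  by (induction rule: gen_subalg.induct) (blast intro: assms(2-)[unfolded Seg_def])+

lemma parity_seg: "s \<in> seg \<Longrightarrow> H.parity s \<in> seg"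
  by (induction rule: seg_induct)
    (simp_all only: parity_f parity_c H.parity_one H.parity_add H.parity_mult H.parity_scale seg_intros)

text \<open>The condition \<open>D * s = parity s * D\<close> is stable under sums, products and
  scalars because \<open>parity\<close> is an automorphism, so the generators suffice.\<close>

lemma dd_seg: "s \<in> seg \<Longrightarrow> dd s = 0"
proof (induction rule: seg_induct)
  case (mult s t)
  then show ?case unfolding super_derivation_def H.parity_mult
    by (metis eq_iff_diff_eq_0 mult.assoc)
qed (auto simp: super_derivation_def parity_f parity_c f_dirac c_dirac H.parity_add H.parity_scale
    algebra_simps H.scale_mult_left[symmetric] H.scale_mult_right[symmetric])

lemma dd_mult: "dd (x * y) = dd x * y + H.parity x * dd y"
  by (simp add: super_derivation_def H.parity_mult algebra_simps)

lemma dd_add: "dd (x + y) = dd x + dd y"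
  by (simp add: super_derivation_def H.parity_add algebra_simps)

lemma dd_diff: "dd (x - y) = dd x - dd y"
  by (simp add: super_derivation_def H.parity_diff algebra_simps)

lemma dd_scale: "dd (sH r x) = sH r (dd x)"
  by (simp add: super_derivation_def H.parity_scale H.scale_mult_left[symmetric]
    H.scale_mult_right[symmetric] H.scale_right_diff_distrib)

lemma dd_zero [simp]: "dd 0 = 0"
  by (simp add: super_derivation_def)

text \<open>The square of an odd derivation is an ordinary derivation; this one is the commutator
  that the hypothesis \<open>starstar\<close> makes vanish.\<close>

lemma dd_dd: "dd (dd x) = dirac\<^sup>2 * x - x * dirac\<^sup>2"
  by (simp add: super_derivation_def H.parity_diff H.parity_mult parity_dirac power2_eq_square
    algebra_simps)

lemma parity_dd: "H.parity (dd x) = - dd (H.parity x)"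
  by (simp add: super_derivation_def H.parity_diff H.parity_mult parity_dirac)

section \<open>Normal form in Seg(W): Clifford monomials times group elements\<close>

definition cliff :: "nat \<Rightarrow> (nat \<Rightarrow> nat) \<Rightarrow> 'h" where
  "cliff m \<epsilon> = prod_list (map (\<lambda>i. c i ^ \<epsilon> i) [1..<Suc m])"

lemma cliff_Suc: "cliff (Suc m) \<epsilon> = cliff m \<epsilon> * c (Suc m) ^ \<epsilon> (Suc m)"
  by (simp add: cliff_def)

lemma cliff_cong: "(\<And>i. i \<in> {1..m} \<Longrightarrow> \<epsilon> i = \<epsilon>' i) \<Longrightarrow> cliff m \<epsilon> = cliff m \<epsilon>'"
  unfolding cliff_def by (intro arg_cong[where f = prod_list] map_cong) auto

text \<open>For \<open>m \<le> n\<close> this is the subalgebra generated by the first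
  \<open>m\<close> of the \<open>c i\<close>. Exponents are functions on all of \<open>nat\<close>,
  so that an induction on \<open>m\<close> can update them freely.\<close>

definition cliff_span :: "nat \<Rightarrow> 'h set" where
  "cliff_span m = H.span (cliff m ` (UNIV \<rightarrow> {0, 1}))"

lemma cliff_span_Suc: "x \<in> cliff_span m \<Longrightarrow> x \<in> cliff_span (Suc m)"
  "x \<in> cliff_span m \<Longrightarrow> x * c (Suc m) \<in> cliff_span (Suc m)"
proof -
  have *: "cliff m \<epsilon> * c (Suc m) ^ e \<in> cliff_span (Suc m)" if "\<epsilon> \<in> UNIV \<rightarrow> {0, 1}" "e \<in> {0, 1}" for \<epsilon> e
  proof -
    have "cliff m \<epsilon> * c (Suc m) ^ e = cliff (Suc m) (\<epsilon>(Suc m := e))"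
      unfolding cliff_Suc using cliff_cong[of m \<epsilon> "\<epsilon>(Suc m := e)"] by simp
    moreover have "\<epsilon>(Suc m := e) \<in> UNIV \<rightarrow> {0, 1}" using that by (auto simp: Pi_iff)
    ultimately show ?thesis unfolding cliff_span_def by (auto intro: H.span_base)
  qed
  show "x \<in> cliff_span (Suc m)" if "x \<in> cliff_span m"
    using that *[where e = 0] unfolding cliff_span_def[of m]
    using H.span_minimal[of "cliff m ` (UNIV \<rightarrow> {0, 1})" "cliff_span (Suc m)"]
    by (auto simp: cliff_span_def H.subspace_span)
  show "x * c (Suc m) \<in> cliff_span (Suc m)" if "x \<in> cliff_span m"
    using that *[where e = 1] unfolding cliff_span_def
    by (rule_tac H.span_mult_subset[where Y = "{c (Suc m)}"]) (auto intro: H.span_base)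
qed

text \<open>Multiplication by the last generator is absorbed by \<open>c i ^ 2 = -1\<close>; an
  earlier generator is first moved past the last one at the cost of a sign, which leaves the
  induction hypothesis.\<close>

lemma cliff_span_mult_c: "m \<le> n \<Longrightarrow> j \<in> {1..m} \<Longrightarrow> x \<in> cliff_span m \<Longrightarrow> x * c j \<in> cliff_span m"
proof (induction m arbitrary: x j)
  case (Suc m)
  have "cliff (Suc m) \<epsilon> * c j \<in> cliff_span (Suc m)" if \<epsilon>: "\<epsilon> \<in> UNIV \<rightarrow> {0, 1}" for \<epsilon>
  proof -
    have y: "cliff m \<epsilon> \<in> cliff_span m" using \<epsilon> by (auto simp: cliff_span_def intro: H.span_base)
    have neg: "- z \<in> cliff_span k" if "z \<in> cliff_span k" for z k
      using that by (simp add: cliff_span_def H.span_neg)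
    have Sm: "Suc m \<in> {1..n}" using Suc.prems by simp
    have \<epsilon>01: "\<epsilon> (Suc m) = 0 \<or> \<epsilon> (Suc m) = 1" using \<epsilon> by (auto simp: Pi_iff)
    consider "j = Suc m" | "j \<in> {1..m}" using Suc.prems by force
    then show ?thesis
    proof cases
      case 1
      have "c (Suc m) ^ \<epsilon> (Suc m) * c j \<in> {c (Suc m), - 1}"
        using \<epsilon>01 c_sq[OF Sm] 1 by auto
      then show ?thesis unfolding cliff_Suc mult.assoc
        using cliff_span_Suc[OF y] neg by auto
    next
      case 2
      have yj: "cliff m \<epsilon> * c j \<in> cliff_span m" using Suc.IH[OF _ 2 y] Suc.prems by simp
      have "c (Suc m) * c j = - (c j * c (Suc m))"
        using rel_c_c[of "Suc m" j] Sm 2 by auto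
      then show ?thesis
        using cliff_span_Suc[OF yj] neg \<epsilon>01 by (auto simp: cliff_Suc mult.assoc)
    qed
  qed
  then show ?case using Suc.prems(3) unfolding cliff_span_def
    by (rule_tac H.span_mult_subset[where Y = "{c j}"]) (auto intro: H.span_base)
qed simp

text \<open>The span contains 1 and is stable under right multiplication by the generators, since
  \<open>rel_w_c\<close> moves group elements to the right of the \<open>c i\<close>. This matches
  elements of \<open>seg\<close> with the right-hand factors of PBW monomials.\<close>

lemma seg_eq_span: "seg = H.span {cliff n \<epsilon> * f w |\<epsilon> w. \<epsilon> \<in> {1..n} \<rightarrow>\<^sub>E {0, 1} \<and> w \<in> W}"
  (is "_ = H.span ?B")
proof
  have pow: "x ^ k \<in> seg" if "x \<in> seg" for x k
    using that by (induction k) (auto intro: seg_intros)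
  have "m \<le> n \<Longrightarrow> cliff m \<epsilon> \<in> seg" for m \<epsilon>
    by (induction m) (auto simp: cliff_Suc cliff_def[of 0] intro!: seg_intros pow)
  then show "H.span ?B \<subseteq> seg"
    by (intro H.span_minimal) (auto intro: seg_intros subspace_seg)
  have B: "cliff n \<epsilon> * f w \<in> H.span ?B" if "\<epsilon> \<in> UNIV \<rightarrow> {0, 1}" "w \<in> W" for \<epsilon> w
  proof -
    have "cliff n \<epsilon> = cliff n (restrict \<epsilon> {1..n})" by (rule cliff_cong) simp
    moreover have "restrict \<epsilon> {1..n} \<in> {1..n} \<rightarrow>\<^sub>E {0, 1}"
      using that(1) unfolding restrict_PiE_iff by blast
    ultimately have "cliff n \<epsilon> * f w \<in> ?B" using that(2) by (metis (mono_tags, lifting) mem_Collect_eq)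
    then show ?thesis by (rule H.span_base)
  qed
  have Cf: "x * f w \<in> H.span ?B" if "x \<in> cliff_span n" "w \<in> W" for x w
    using that B unfolding cliff_span_def
    by (rule_tac H.span_mult_subset[where Y = "{f w}"]) (auto intro: H.span_base)
  have C: "cliff n \<epsilon> \<in> cliff_span n" if "\<epsilon> \<in> {1..n} \<rightarrow>\<^sub>E {0, 1}" for \<epsilon>
  proof -
    have "cliff n \<epsilon> = cliff n (\<lambda>i. if i \<in> {1..n} then \<epsilon> i else 0)" by (rule cliff_cong) simp
    moreover have "(\<lambda>i. if i \<in> {1..n} then \<epsilon> i else 0) \<in> UNIV \<rightarrow> {0, 1}" using that by (auto simp: PiE_iff)
    ultimately show ?thesis unfolding cliff_span_def by (auto intro: H.span_base)
  qed
  have "x * s \<in> H.span ?B" if "s \<in> seg" "x \<in> H.span ?B" for x s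
    using that
  proof (induction s arbitrary: x rule: seg_induct)
    case (f v)
    show ?case
    proof (rule H.span_mult_subset[OF _ f(2) H.span_base[of _ "{f v}"]])
      fix y z assume "y \<in> ?B" "z \<in> {f v}"
      then show "y * z \<in> H.span ?B" using f_comp[of _ v] W_group(3)[of _ v] f(1) C Cf
        by (auto simp: mult.assoc) (metis (no_types, lifting))
    qed simp
  next
    case (c i)
    show ?case
    proof (rule H.span_mult_subset[OF _ c(2) H.span_base[of _ "{c i}"]])
      fix y z assume "y \<in> ?B" "z \<in> {c i}"
      then obtain \<epsilon> w where y: "y = cliff n \<epsilon> * f w" "\<epsilon> \<in> {1..n} \<rightarrow>\<^sub>E {0, 1}" "w \<in> W" "z = c i" by blast
      have "cliff n \<epsilon> * (\<Sum>j=1..n. sH (rep_coeff w i j) (c j)) \<in> cliff_span n"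
        using cliff_span_mult_c[of n _ "cliff n \<epsilon>"] C[OF y(2)] unfolding H.mult_sum_scale cliff_span_def
        by (auto intro!: H.span_sum H.span_scale)
      then have "cliff n \<epsilon> * (\<Sum>j=1..n. sH (rep_coeff w i j) (c j)) * f w \<in> H.span ?B"
        using Cf y(3) by blast
      then show "y * z \<in> H.span ?B"
        using rel_w_c[OF y(3) c(1)] y by (simp add: mult.assoc lin_ext_def rep_coeff_def)
    qed simp
  qed (auto simp: distrib_left H.scale_mult_right[symmetric] mult.assoc[symmetric]
      intro: H.span_add H.span_scale)
  moreover have "1 \<in> H.span ?B"
    using B[of "\<lambda>_. 0" id] f_id W_group(2) by (simp add: cliff_def map_replicate_const)
  ultimately show "seg \<subseteq> H.span ?B" by force
qed

section \<open>The filtration by degree\<close>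

abbreviation a_word :: "nat list \<Rightarrow> 'h" where
  "a_word l \<equiv> prod_list (map a l)"

text \<open>Degree at most \<open>m\<close> in the \<open>a i\<close>. Arbitrary words make
  multiplication by \<open>a i\<close> immediate; \<open>filt_eq_pow\<close> returns to ordered
  monomials.\<close>

definition filt :: "nat \<Rightarrow> 'h set" where
  "filt m = H.span {a_word l * s |l s. set l \<subseteq> {1..n} \<and> length l \<le> m \<and> s \<in> seg}"

lemma subspace_filt: "H.subspace (filt m)"
  by (simp add: filt_def)

lemma filt_intros:
  "0 \<in> filt m" "x \<in> filt m \<Longrightarrow> y \<in> filt m \<Longrightarrow> x + y \<in> filt m"
  "x \<in> filt m \<Longrightarrow> y \<in> filt m \<Longrightarrow> x - y \<in> filt m" "x \<in> filt m \<Longrightarrow> - x \<in> filt m"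
  "x \<in> filt m \<Longrightarrow> sH r x \<in> filt m"
  "(\<And>i. i \<in> A \<Longrightarrow> g i \<in> filt m) \<Longrightarrow> sum g A \<in> filt m"
  unfolding filt_def
  by (simp_all add: H.span_zero H.span_add H.span_diff H.span_neg H.span_scale H.span_sum)

lemma filt_base: "set l \<subseteq> {1..n} \<Longrightarrow> length l \<le> m \<Longrightarrow> s \<in> seg \<Longrightarrow> a_word l * s \<in> filt m"
  unfolding filt_def by (intro H.span_base) blast

lemma filt_mono: "m \<le> m' \<Longrightarrow> x \<in> filt m \<Longrightarrow> x \<in> filt m'"
  unfolding filt_def by (erule set_mp[OF H.span_mono, rotated]) force

lemma filt_mult_left:
  assumes "x \<in> filt m"
    "\<And>l s. set l \<subseteq> {1..n} \<Longrightarrow> length l \<le> m \<Longrightarrow> s \<in> seg \<Longrightarrow> y * (a_word l * s) \<in> filt m'"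
  shows "y * x \<in> filt m'"
  unfolding filt_def
proof (rule H.span_mult_subset[OF _ H.span_base[of y "{y}"] assms(1)[unfolded filt_def]])
qed (use assms(2)[unfolded filt_def] in blast)+

lemma filt_mult_seg:
  assumes "x \<in> filt m" "t \<in> seg"
  shows "x * t \<in> filt m"
  unfolding filt_def
proof (rule H.span_mult_subset[OF _ assms(1)[unfolded filt_def] H.span_base[of t "{t}"]])
  fix y z assume "y \<in> {a_word l * s |l s. set l \<subseteq> {1..n} \<and> length l \<le> m \<and> s \<in> seg}" "z \<in> {t}"
  then obtain l s where "y * z = a_word l * (s * t)" "set l \<subseteq> {1..n}" "length l \<le> m" "s \<in> seg"
    by (auto simp: mult.assoc)
  then show "y * z \<in> H.span {a_word l * s |l s. set l \<subseteq> {1..n} \<and> length l \<le> m \<and> s \<in> seg}"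
    using filt_base[of l m "s * t"] assms(2) seg_intros(4) by (simp add: filt_def)
qed simp

lemma a_mult_filt: "i \<in> {1..n} \<Longrightarrow> x \<in> filt m \<Longrightarrow> a i * x \<in> filt (Suc m)"
  using filt_base[of "i # l" "Suc m" s for l s]
  by (rule_tac filt_mult_left) (auto simp: mult.assoc)

lemma filt_0: "filt 0 = seg"
proof -
  have "{a_word l * s |l s. set l \<subseteq> {1..n} \<and> length l \<le> 0 \<and> s \<in> seg} = seg" by force
  then show ?thesis unfolding filt_def by (metis H.span_eq_iff subspace_seg)
qed

text \<open>Group elements act linearly on the \<open>a j\<close> and each \<open>c j\<close> passes
  an \<open>a i\<close> up to sign, so moving \<open>seg\<close> to the right of one letter yields
  exactly one letter again.\<close>

lemma seg_mult_a:
  "s \<in> seg \<Longrightarrow> i \<in> {1..n} \<Longrightarrow> s * a i \<in> H.span {a j * t |j t. j \<in> {1..n} \<and> t \<in> seg}"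
proof (induction s arbitrary: i rule: seg_induct)
  case (f w)
  have "f w * a i = f w * a i * f (inv w) * f w" by (simp add: mult.assoc f_inv f(1))
  also have "\<dots> = (\<Sum>j=1..n. sH (rep_coeff w i j) (a j * f w))"
    unfolding conj_a[OF f] H.sum_scale_mult ..
  finally have "f w * a i = (\<Sum>j=1..n. sH (rep_coeff w i j) (a j * f w))" .
  moreover have "a j * f w \<in> H.span {a j * t |j t. j \<in> {1..n} \<and> t \<in> seg}" if "j \<in> {1..n}" for j
    using that f(1) seg_intros(2) by (intro H.span_base) blast
  ultimately show ?case by (simp only:) (intro H.span_sum H.span_scale)
next
  case (c j)
  have "c j * a i = a i * (if i = j then - c j else c j)"
    using rel_c_a[OF c(2,1)] rel_c_a_same[OF c(1)] by auto
  moreover have "(if i = j then - c j else c j) \<in> seg" using seg_intros(3,7) c(1) by presburger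
  ultimately have "c j * a i \<in> {a j * t |j t. j \<in> {1..n} \<and> t \<in> seg}" using c(2) by blast
  then show ?case by (rule H.span_base)
next
  case one
  have "a i * 1 \<in> {a j * t |j t. j \<in> {1..n} \<and> t \<in> seg}" using one seg_intros(1) by blast
  then show ?case using H.span_base by simp
next
  case (mult s t)
  have t: "x * t' \<in> H.span {a j * t |j t. j \<in> {1..n} \<and> t \<in> seg}"
    if "t' \<in> seg" "x \<in> H.span {a j * t |j t. j \<in> {1..n} \<and> t \<in> seg}" for x t'
  proof (rule H.span_mult_subset[OF _ that(2) H.span_base[of t' "{t'}"]])
    fix y z assume "y \<in> {a j * t |j t. j \<in> {1..n} \<and> t \<in> seg}" "z \<in> {t'}"
    then obtain j u where "y * z = a j * (u * t')" "j \<in> {1..n}" "u \<in> seg"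
      by (auto simp: mult.assoc)
    then show "y * z \<in> H.span {a j * t |j t. j \<in> {1..n} \<and> t \<in> seg}"
      using seg_intros(4)[OF _ that(1)] by (intro H.span_base) blast
  qed simp
  have "s * (t * a i) \<in> H.span {a j * t |j t. j \<in> {1..n} \<and> t \<in> seg}"
  proof (rule H.span_mult_subset[OF _ H.span_base[of s "{s}"] mult(4)[OF mult(5)]])
    fix x y assume "x \<in> {s}" "y \<in> {a j * t |j t. j \<in> {1..n} \<and> t \<in> seg}"
    then obtain j u where x: "x = s" "y = a j * u" "j \<in> {1..n}" "u \<in> seg" by blast
    then show "x * y \<in> H.span {a j * t |j t. j \<in> {1..n} \<and> t \<in> seg}"
      using t[OF x(4) mult(3)[OF x(3)]] by (simp add: mult.assoc)
  qed simp
  then show ?case by (simp add: mult.assoc)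
qed (auto simp: distrib_right H.scale_mult_left[symmetric] intro: H.span_add H.span_scale)

text \<open>The factor \<open>s\<close> is moved through the word letter by letter with
  \<open>seg_mult_a\<close>.\<close>

lemma seg_mult_filt:
  assumes "x \<in> filt m" "s \<in> seg"
  shows "s * x \<in> filt m"
proof -
  have "set l \<subseteq> {1..n} \<Longrightarrow> t \<in> seg \<Longrightarrow> s \<in> seg \<Longrightarrow> s * (a_word l * t) \<in> filt (length l)" for l s t
  proof (induction l arbitrary: s)
    case Nil
    then show ?case by (simp add: filt_0 seg_intros)
  next
    case (Cons i l)
    have "s * a i * (a_word l * t) \<in> filt (Suc (length l))"
      unfolding filt_def[of "Suc (length l)"]
    proof (rule H.span_mult_subset[OF _ seg_mult_a H.span_base])
      fix x y assume "x \<in> {a j * t |j t. j \<in> {1..n} \<and> t \<in> seg}" "y \<in> {a_word l * t}"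
      then obtain j u where x: "x = a j * u" "y = a_word l * t" "j \<in> {1..n}" "u \<in> seg" by blast
      then show "x * y \<in> H.span {a_word l' * s |l' s. set l' \<subseteq> {1..n} \<and> length l' \<le> Suc (length l) \<and> s \<in> seg}"
        using a_mult_filt[OF x(3) Cons.IH[OF _ Cons.prems(2) x(4)]] Cons.prems
        by (simp add: mult.assoc filt_def)
    qed (use Cons.prems in auto)
    then show ?case by (simp add: mult.assoc)
  qed
  then show ?thesis using assms by (intro filt_mult_left[OF assms(1)]) (blast intro: filt_mono)
qed

section \<open>Commutativity of the letters modulo lower degree\<close>

lemma a_commutator:
  assumes "i \<in> {1..n}" "j \<in> {1..n}"
  shows "a i * a j - a j * a i \<in> seg"
proof (cases "i = j")
  case False
  \<comment> \<open>\<open>c i * c j\<close> is a unit of \<open>seg\<close> with inverse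
    \<open>c j * c i\<close>, so it can be cancelled from \<open>rel_a_a\<close>.\<close>
  have "a i * a j - a j * a i = (a i * a j - a j * a i) * (c i * (c j * (c j * c i)))"
    using assms by (simp only: c_sq_left c_sq mult_minus_right minus_minus mult_1_right)
  moreover have "(a i * a j - a j * a i) * c i * c j * (c j * c i) \<in> seg"
    using rel_a_a[OF assms False] assms by (simp only: seg_intros)
  ultimately show ?thesis by (simp only: mult.assoc)
qed (simp add: seg_intros)

text \<open>Each exchange of neighbours replaces two letters by a commutator in \<open>seg\<close>,
  so the error has lower degree than the word.\<close>

lemma a_word_move:
  assumes "i \<in> {1..n}" "set p \<subseteq> {1..n}" "set q \<subseteq> {1..n}"
  shows "a_word (p @ i # q) - a_word (i # p @ q) \<in> filt (length p + length q)"
  using assms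
proof (induction p)
  case Nil
  then show ?case by (simp add: filt_intros)
next
  case (Cons j p)
  have w: "a_word (p @ q) \<in> filt (length p + length q)"
    using filt_base[of "p @ q" "length p + length q" 1] Cons.prems seg_intros(1) by simp
  have "a_word ((j # p) @ i # q) - a_word (i # (j # p) @ q)
      = a j * (a_word (p @ i # q) - a_word (i # p @ q)) + (a j * a i - a i * a j) * a_word (p @ q)"
    by (simp add: algebra_simps)
  moreover have "\<dots> \<in> filt (Suc (length p + length q))"
    using Cons a_mult_filt[of j]
      filt_mono[of _ "Suc (length p + length q)", OF _ seg_mult_filt[OF w a_commutator[of j i]]]
    by (intro filt_intros) auto
  ultimately show ?case by simp
qed

text \<open>The first letter of \<open>l\<close> is moved to the front of \<open>l'\<close>, and the
  tails are compared by induction.\<close>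

lemma a_word_perm:
  assumes "mset l = mset l'" "set l \<subseteq> {1..n}" "length l \<le> Suc m"
  shows "a_word l - a_word l' \<in> filt m"
  using assms
proof (induction l arbitrary: l' m)
  case Nil
  then show ?case by (simp add: filt_intros)
next
  case (Cons i r)
  have "i \<in> set l'" using Cons.prems(1) by (metis list.set_intros(1) set_mset_mset)
  then obtain p q where l': "l' = p @ i # q" by (metis split_list)
  have mset: "mset r = mset (p @ q)" using Cons.prems(1) l' by simp
  then have len: "length r = length p + length q" and set: "set p \<subseteq> {1..n}" "set q \<subseteq> {1..n}"
    using Cons.prems(2) mset_eq_length[OF mset] mset_eq_setD[OF mset] by auto
  have "a i * (a_word r - a_word (p @ q)) \<in> filt m"
  \<comment> \<open>For \<open>m = 0\<close> the word has a single letter and both tails are empty;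
    otherwise prefixing \<open>a i\<close> raises the degree by one.\<close>
  proof (cases m)
    case 0
    then show ?thesis using Cons.prems(3) len by (simp add: filt_intros)
  next
    case (Suc m')
    then show ?thesis using Cons.IH[OF mset, of m'] Cons.prems by (auto intro: a_mult_filt)
  qed
  moreover have "a_word l' - a_word (i # p @ q) \<in> filt m"
    using a_word_move[OF _ set, of i] Cons.prems len l' by (auto intro: filt_mono)
  ultimately have "a i * (a_word r - a_word (p @ q)) - (a_word l' - a_word (i # p @ q)) \<in> filt m"
    by (rule filt_intros)
  then show ?case by (simp add: algebra_simps)
qed

section \<open>Ordered monomials and total degree\<close>

definition a_pow :: "(nat \<Rightarrow> nat) \<Rightarrow> 'h" where
  "a_pow k = prod_list (map (\<lambda>i. a i ^ k i) [1..<Suc n])"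

definition exp_word :: "nat \<Rightarrow> (nat \<Rightarrow> nat) \<Rightarrow> nat list" where
  "exp_word m k = concat (map (\<lambda>i. replicate (k i) i) [1..<Suc m])"

definition tdeg :: "(nat \<Rightarrow> nat) \<Rightarrow> nat" where
  "tdeg k = (\<Sum>i=1..n. k i)"

abbreviation exps :: "(nat \<Rightarrow> nat) set" where
  "exps \<equiv> {1..n} \<rightarrow>\<^sub>E UNIV"

lemma a_pow_eq_word: "a_pow k = a_word (exp_word n k)"
proof -
  have "prod_list (map (\<lambda>i. a i ^ k i) [1..<Suc m]) = a_word (exp_word m k)" for m
    by (induction m) (auto simp: exp_word_def prod_list_replicate)
  then show ?thesis by (simp add: a_pow_def)
qed

lemma count_exp_word: "count (mset (exp_word m k)) i = (if i \<in> {1..m} then k i else 0)"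
  by (induction m) (auto simp: exp_word_def)

lemma set_exp_word: "set (exp_word m k) \<subseteq> {1..m}"
  by (auto simp: exp_word_def)

lemma length_exp_word: "length (exp_word n k) = tdeg k"
proof -
  have "length (exp_word m k) = (\<Sum>i=1..m. k i)" for m
    by (induction m) (auto simp: exp_word_def)
  then show ?thesis by (simp add: tdeg_def)
qed

lemma a_pow_filt: "tdeg k \<le> m \<Longrightarrow> s \<in> seg \<Longrightarrow> a_pow k * s \<in> filt m"
  using filt_base[of "exp_word n k" m s] set_exp_word[of n k]
  by (simp add: a_pow_eq_word length_exp_word)

text \<open>Adding \<open>k i\<close> on the left avoids truncated subtraction.\<close>

lemma tdeg_upd: "i \<in> {1..n} \<Longrightarrow> tdeg (k(i := x)) + k i = tdeg k + x"
  unfolding tdeg_def by (simp add: sum.remove[of _ i])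

lemma mset_exp_word_Suc:
  "i \<in> {1..n} \<Longrightarrow> mset (exp_word n (k(i := Suc (k i)))) = add_mset i (mset (exp_word n k))"
  by (rule multiset_eqI) (simp add: count_exp_word)

lemma a_pow_Suc:
  assumes "i \<in> {1..n}"
  shows "a i * a_pow k - a_pow (k(i := Suc (k i))) \<in> filt (tdeg k)"
    and "a_pow k * a i - a_pow (k(i := Suc (k i))) \<in> filt (tdeg k)"
  using a_word_perm[of "i # exp_word n k" "exp_word n (k(i := Suc (k i)))" "tdeg k"]
    a_word_perm[of "exp_word n k @ [i]" "exp_word n (k(i := Suc (k i)))" "tdeg k"]
    assms set_exp_word[of n k]
  by (simp_all add: a_pow_eq_word length_exp_word mset_exp_word_Suc)

text \<open>By \<open>a_word_perm\<close> a word equals its sorted form up to lower degree, and the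
  error is covered by induction on \<open>m\<close>.\<close>

lemma filt_eq_pow: "filt m = H.span {a_pow k * s |k s. k \<in> exps \<and> tdeg k \<le> m \<and> s \<in> seg}"
proof
  show "H.span {a_pow k * s |k s. k \<in> exps \<and> tdeg k \<le> m \<and> s \<in> seg} \<subseteq> filt m"
    by (intro H.span_minimal subspace_filt) (auto intro: a_pow_filt)
  show "filt m \<subseteq> H.span {a_pow k * s |k s. k \<in> exps \<and> tdeg k \<le> m \<and> s \<in> seg}"
  proof (induction m)
    case 0
    \<comment> \<open>The zero exponent is restricted to \<open>{1..n}\<close> because
      \<open>exps\<close> contains only extensional functions.\<close>
    have one: "a_pow (restrict (\<lambda>_. 0) {1..n}) = 1"
    proof -
      have "map (\<lambda>i. a i ^ restrict (\<lambda>_. 0) {1..n} i) [1..<Suc n] = map (\<lambda>_. 1) [1..<Suc n]"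
        by (intro map_cong) auto
      then show ?thesis unfolding a_pow_def by (simp only: map_replicate_const prod_list_replicate power_one)
    qed
    have "s \<in> {a_pow k * s |k s. k \<in> exps \<and> tdeg k \<le> 0 \<and> s \<in> seg}" if "s \<in> seg" for s
    proof -
      have "s = a_pow (restrict (\<lambda>_. 0) {1..n}) * s" by (simp only: one mult_1_left)
      moreover have "tdeg (restrict (\<lambda>_. 0) {1..n}) \<le> 0" by (simp add: tdeg_def)
      moreover have "restrict (\<lambda>_. 0) {1..n} \<in> exps" unfolding restrict_PiE_iff by simp
      ultimately show ?thesis using that by (intro CollectI exI conjI)
    qed
    then show ?case unfolding filt_0 by (auto intro: H.span_base)
  next
    case (Suc m)
    let ?S = "\<lambda>m. {a_pow k * s |k s. k \<in> exps \<and> tdeg k \<le> m \<and> s \<in> seg}"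
    have IH: "x \<in> H.span (?S (Suc m))" if "x \<in> filt m" for x
    proof -
      have "?S m \<subseteq> ?S (Suc m)" using le_SucI by blast
      then show ?thesis using that Suc.IH H.span_mono by blast
    qed
    have "a_word l * s \<in> H.span (?S (Suc m))"
      if l: "set l \<subseteq> {1..n}" "length l \<le> Suc m" "s \<in> seg" for l s
    proof -
      define k where "k = restrict (\<lambda>i. count (mset l) i) {1..n}"
      have mset: "mset l = mset (exp_word n k)"
        using l(1) by (intro multiset_eqI) (auto simp: count_exp_word k_def count_eq_zero_iff)
      have "tdeg k \<le> Suc m" using mset_eq_length[OF mset] l(2) by (simp add: length_exp_word)
      moreover have "k \<in> exps" unfolding k_def by simp
      ultimately have "a_pow k * s \<in> H.span (?S (Suc m))" using l(3) by (intro H.span_base) blast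
      moreover have "(a_word l - a_pow k) * s \<in> H.span (?S (Suc m))"
        using a_word_perm[OF mset l(1,2)] l(3) unfolding a_pow_eq_word[of k] by (intro IH filt_mult_seg)
      ultimately have "a_pow k * s + (a_word l - a_pow k) * s \<in> H.span (?S (Suc m))"
        by (rule H.span_add)
      then show ?thesis by (simp add: algebra_simps)
    qed
    then show ?case unfolding filt_def[of "Suc m"] by (intro H.span_minimal) auto
  qed
qed

lemma pbw_monomial_eq: "pbw_monomial n f c a (k, \<epsilon>, w) = a_pow k * (cliff n \<epsilon> * f w)"
  by (simp add: pbw_monomial_def a_pow_def cliff_def mult.assoc)

lemma filt_exhaust: "\<exists>m. x \<in> filt m"
proof -
  have "x \<in> H.span (pbw_monomial n f c a ` pbw_index W n)" using pbw_span by simp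
  then show ?thesis
  proof (induction rule: H.span_induct_alt)
    case base
    then show ?case using filt_intros(1) by blast
  next
    case (step r x y)
    then obtain m where "y \<in> filt m" by blast
    obtain k \<epsilon> w where x: "x = a_pow k * (cliff n \<epsilon> * f w)" "\<epsilon> \<in> {1..n} \<rightarrow>\<^sub>E {0, 1}" "w \<in> W"
      using step(1) by (auto simp: pbw_index_def pbw_monomial_eq)
    have "cliff n \<epsilon> * f w \<in> seg" unfolding seg_eq_span using x by (intro H.span_base) blast
    then have "x \<in> filt (tdeg k)" using x a_pow_filt by blast
    then have "sH r x + y \<in> filt (max m (tdeg k))"
      using \<open>y \<in> filt m\<close> filt_mono[OF max.cobounded1] filt_mono[OF max.cobounded2]
      by (intro filt_intros)
    then show ?case ..
  qed
qed

section \<open>Contracting the associated graded complex\<close>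

text \<open>Unspecified if all exponents vanish on \<open>{1..n}\<close>;
  \<open>contract_pow\<close> tests for that case.\<close>

definition lead :: "(nat \<Rightarrow> nat) \<Rightarrow> nat" where
  "lead k = (LEAST i. i \<in> {1..n} \<and> k i \<noteq> 0)"

lemma lead_props:
  assumes "tdeg k \<noteq> 0"
  shows "lead k \<in> {1..n}" "k (lead k) \<noteq> 0"
proof -
  have "\<exists>i. i \<in> {1..n} \<and> k i \<noteq> 0" using assms by (auto simp: tdeg_def)
  then show "lead k \<in> {1..n}" "k (lead k) \<noteq> 0" unfolding lead_def by (metis (mono_tags, lifting) LeastI)+
qed

lemma lead_eqI: "i \<in> {1..n} \<Longrightarrow> k i \<noteq> 0 \<Longrightarrow> (\<And>j. j \<in> {1..n} \<Longrightarrow> j < i \<Longrightarrow> k j = 0) \<Longrightarrow> lead k = i"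
  unfolding lead_def by (rule Least_equality) (auto simp: not_less[symmetric])

lemma lead_min: "j \<in> {1..n} \<Longrightarrow> j < lead k \<Longrightarrow> k j = 0"
  using not_less_Least[of j "\<lambda>i. i \<in> {1..n} \<and> k i \<noteq> 0"] by (auto simp: lead_def)

lemma c_mult_a_word:
  assumes "j \<in> {1..n}" "set l \<subseteq> {1..n}"
  shows "c j * a_word l = (if odd (count_list l j) then - (a_word l * c j) else a_word l * c j)"
  using assms
proof (induction l)
  case (Cons i l)
  have "c j * (a i * a_word l) = (if i = j then - (a i * (c j * a_word l)) else a i * (c j * a_word l))"
    using rel_c_a[of i j] rel_c_a_same[of j] Cons.prems by (simp add: mult.assoc[symmetric])
  then show ?case using Cons by (simp add: mult.assoc)
qed simp

lemma c_mult_a_pow: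
  "j \<in> {1..n} \<Longrightarrow> c j * a_pow k = (if odd (k j) then - (a_pow k * c j) else a_pow k * c j)"
  using c_mult_a_word[of j "exp_word n k"] set_exp_word[of n k] count_exp_word[of n k j]
  by (simp add: a_pow_eq_word count_mset)

lemma parity_a_word: "set l \<subseteq> {1..n} \<Longrightarrow> H.parity (a_word l) = a_word l"
  by (induction l) (auto simp: H.parity_mult parity_a)

lemma parity_a_pow: "H.parity (a_pow k) = a_pow k"
  unfolding a_pow_eq_word by (rule parity_a_word[OF set_exp_word])

text \<open>The coefficient is \<open>(-1)^(k i) - 1\<close>: in the supercommutator with
  \<open>a i * c i\<close> only the first term moves \<open>c i\<close> through the
  monomial.\<close>

definition symb :: "(nat \<Rightarrow> nat) \<Rightarrow> nat \<Rightarrow> 'h" where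
  "symb k i = (if odd (k i) then sH (-2) (a_pow (k(i := Suc (k i))) * c i) else 0)"

lemma sH_2: "sH 2 x = x + x" "sH (-2) x = - x - x"
  by (simp_all only: H.scale_minus_left one_add_one[symmetric] H.scale_left_distrib H.scale_one) simp

text \<open>The associated graded map of \<open>dd\<close> sends \<open>a_pow k\<close> to the sum of the terms \<open>symb k i\<close>.\<close>
lemma dd_a_pow: "dd (a_pow k) - (\<Sum>i=1..n. symb k i) \<in> filt (tdeg k)"
proof -
  have "dd (a_pow k) = (\<Sum>i=1..n. a i * (c i * a_pow k) - a_pow k * a i * c i)"
    by (simp add: super_derivation_def parity_a_pow dirac_element_def sum_distrib_left
        sum_distrib_right sum_subtractf mult.assoc)
  moreover have "a i * (c i * a_pow k) - a_pow k * a i * c i - symb k i \<in> filt (tdeg k)"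
    if i: "i \<in> {1..n}" for i
  proof -
    let ?L = "a i * a_pow k - a_pow (k(i := Suc (k i)))"
    let ?R = "a_pow k * a i - a_pow (k(i := Suc (k i)))"
    \<comment> \<open>In the even case the leading terms cancel; in the odd case they add up to
      \<open>symb k i\<close>.\<close>
    have "a i * (c i * a_pow k) - a_pow k * a i * c i - symb k i
        = (if odd (k i) then - ?L - ?R else ?L - ?R) * c i"
      by (simp add: c_mult_a_pow[OF i] symb_def sH_2 algebra_simps)
    moreover have "(if odd (k i) then - ?L - ?R else ?L - ?R) \<in> filt (tdeg k)"
      using a_pow_Suc[OF i, of k] filt_intros(3,4) by presburger
    ultimately show ?thesis using i by (simp only: filt_mult_seg seg_intros)
  qed
  ultimately show ?thesis by (simp only: sum_subtractf[symmetric] filt_intros(6))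
qed

text \<open>Inverts \<open>symb\<close> at the leading index: the factor 1/2 undoes the -2 up to a
  sign, which \<open>c i ^ 2 = -1\<close> supplies.\<close>

definition contract_pow :: "(nat \<Rightarrow> nat) \<Rightarrow> 'h" where
  "contract_pow k = (if tdeg k \<noteq> 0 \<and> even (k (lead k))
     then sH (1/2) (a_pow (k(lead k := k (lead k) - 1)) * c (lead k)) else 0)"

text \<open>
  On the associated graded space, \<open>dd\<close> is a tensor product of one complex per index \<open>i\<close>, each with
  an explicit contraction onto the part of degree 0; \<open>contract\<close> uses the contraction
  of the first index with a nonzero exponent.
\<close>
definition contract :: "'h \<Rightarrow> 'h" where
  "contract = (SOME g. Vector_Spaces.linear sH sH g \<and>
     (\<forall>k\<in>exps. \<forall>s\<in>seg. g (a_pow k * s) = contract_pow k * s))"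

text \<open>The map is prescribed on the PBW basis and extended linearly; \<open>seg_eq_span\<close>
  then gives the formula for every right factor in \<open>seg\<close>.\<close>

lemma contract_linear: "Vector_Spaces.linear sH sH contract"
  and contract_a_pow: "k \<in> exps \<Longrightarrow> s \<in> seg \<Longrightarrow> contract (a_pow k * s) = contract_pow k * s"
proof -
  interpret HH: vector_space_pair sH sH by unfold_locales
  \<comment> \<open>By \<open>pbw_inj\<close> the index of a PBW monomial can be recovered from the
    monomial.\<close>
  define g0 where "g0 x = (case inv_into (pbw_index W n) (pbw_monomial n f c a) x of
    (k, \<epsilon>, w) \<Rightarrow> contract_pow k * (cliff n \<epsilon> * f w))" for x
  obtain g where g: "Vector_Spaces.linear sH sH g"
    "\<forall>x\<in>pbw_monomial n f c a ` pbw_index W n. g x = g0 x"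
    using HH.linear_independent_extend[OF pbw_independent, of g0] by blast
  interpret g: Vector_Spaces.linear sH sH g by (rule g(1))
  have "g (a_pow k * s) = contract_pow k * s" if k: "k \<in> exps" and s: "s \<in> seg" for k s
    using s unfolding seg_eq_span
  proof (induction rule: H.span_induct_alt)
    case base
    then show ?case by (simp add: g.zero)
  next
    case (step r x y)
    then obtain \<epsilon> w where x: "x = cliff n \<epsilon> * f w" "\<epsilon> \<in> {1..n} \<rightarrow>\<^sub>E {0, 1}" "w \<in> W" by blast
    have idx: "(k, \<epsilon>, w) \<in> pbw_index W n" using k x by (simp add: pbw_index_def)
    have "g (a_pow k * x) = contract_pow k * x"
      using g(2) idx inv_into_f_f[OF pbw_inj idx] x(1)
      by (simp add: g0_def pbw_monomial_eq[symmetric])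
    then show ?case using step(2)
      by (simp add: distrib_left H.scale_mult_right[symmetric] g.add g.scale)
  qed
  with g(1) have "\<exists>g. Vector_Spaces.linear sH sH g \<and>
     (\<forall>k\<in>exps. \<forall>s\<in>seg. g (a_pow k * s) = contract_pow k * s)" by blast
  from someI_ex[OF this, folded contract_def]
  show "Vector_Spaces.linear sH sH contract"
    "k \<in> exps \<Longrightarrow> s \<in> seg \<Longrightarrow> contract (a_pow k * s) = contract_pow k * s" by blast+
qed

interpretation contract: Vector_Spaces.linear sH sH contract
  by (rule contract_linear)

text \<open>Truncation in \<open>m - 1\<close> is harmless, as \<open>contract_pow\<close> vanishes
  in degree 0.\<close>

lemma contract_pow_filt:
  assumes "tdeg k \<le> m" "s \<in> seg"
  shows "contract_pow k * s \<in> filt (m - 1)"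
proof (cases "tdeg k \<noteq> 0 \<and> even (k (lead k))")
  case True
  note j = lead_props[OF conjunct1[OF True]]
  have "tdeg (k(lead k := k (lead k) - 1)) \<le> m - 1"
    using tdeg_upd[OF j(1), of k "k (lead k) - 1"] j(2) assms(1) by linarith
  then have "a_pow (k(lead k := k (lead k) - 1)) * (c (lead k) * s) \<in> filt (m - 1)"
    using assms(2) j(1) by (intro a_pow_filt seg_intros)
  then show ?thesis using True by (simp add: contract_pow_def H.scale_mult_left[symmetric] filt_intros mult.assoc)
qed (auto simp: contract_pow_def filt_intros)

lemma contract_filt: "x \<in> filt m \<Longrightarrow> contract x \<in> filt (m - 1)"
  unfolding filt_eq_pow[of m]
proof (induction rule: H.span_induct_alt)
  case (step r x y)
  then show ?case
    by (auto simp: contract.add contract.scale contract_a_pow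
        simp del: One_nat_def intro!: filt_intros contract_pow_filt)
qed (simp add: contract.zero filt_intros)

lemma contract_seg:
  assumes "s \<in> seg"
  shows "contract s = 0"
  using assms[folded filt_0, unfolded filt_eq_pow]
proof (induction rule: H.span_induct_alt)
  case (step r x y)
  then show ?case
    by (auto simp: contract.add contract.scale contract_a_pow contract_pow_def)
qed (simp add: contract.zero)

lemma half_scale: "sH (-2) (sH (1/2) x) = - x" "sH (1/2) (sH (-2) x) = - x"
  by (simp_all add: H.scale_minus_left)

text \<open>Raising the exponent at the leading index makes it even, and contracting returns the
  monomial. Raising another one keeps the leading parity: the term dies if that is odd and becomes a
  mixed term if it is even.\<close>

lemma contract_symb:
  assumes k: "k \<in> exps" "tdeg k \<noteq> 0" and i: "i \<in> {1..n}" and s: "s \<in> seg"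
  shows "contract (symb k i * s) =
    (if odd (k (lead k)) then if i = lead k then a_pow k * s else 0
     else if odd (k i) then - (a_pow ((k(i := Suc (k i)))(lead k := k (lead k) - 1)) * c (lead k) * c i * s)
     else 0)"
proof (cases "odd (k i)")
  case True
  note j = lead_props[OF k(2)]
  let ?k = "k(i := Suc (k i))"
  have k': "?k \<in> exps" using k(1) i by (auto simp: PiE_iff extensional_def)
  \<comment> \<open>An odd exponent is nonzero, so \<open>i\<close> cannot precede the leading
    index.\<close>
  have le: "lead k \<le> i" using lead_min[OF i] True by (metis even_zero not_le)
  have lead: "lead ?k = lead k"
    using j le lead_min[of _ k] by (intro lead_eqI) auto
  have deg: "tdeg ?k \<noteq> 0" using tdeg_upd[OF i, of k "Suc (k i)"] by linarith
  have "contract (symb k i * s) = sH (-2) (contract (a_pow ?k * (c i * s)))"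
    using True by (simp add: symb_def H.scale_mult_left[symmetric] mult.assoc contract.neg contract.scale)
  also have "\<dots> = sH (-2) (contract_pow ?k * (c i * s))"
    using k' i s by (simp only: contract_a_pow seg_intros)
  also have "\<dots> = (if odd (k (lead k)) then if i = lead k then a_pow k * s else 0
     else - (a_pow (?k(lead k := k (lead k) - 1)) * c (lead k) * c i * s))"
  proof (cases "i = lead k")
    case eq: True
    then show ?thesis using True deg c_sq_left[OF i] unfolding contract_pow_def lead
      by (simp add: eq[symmetric] H.scale_mult_left[symmetric] half_scale mult.assoc)
  next
    case False
    then show ?thesis using True deg unfolding contract_pow_def lead
      by (simp add: H.scale_mult_left[symmetric] half_scale mult.assoc)
  qed
  finally show ?thesis using True by simp
qed (auto simp: symb_def contract.zero)

text \<open>Let \<open>j\<close> be the leading index. If \<open>k j\<close> is odd,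
  \<open>contract\<close> kills the monomial and the term \<open>i = j\<close> of
  \<open>contract (dd x)\<close> restores it. If \<open>k j\<close> is even, the term
  \<open>i = j\<close> of \<open>dd (contract x)\<close> restores it, and the mixed terms of the two
  composites cancel.\<close>

lemma contract_homotopy_pow:
  assumes k: "k \<in> exps" "tdeg k \<noteq> 0" and s: "s \<in> seg"
  shows "dd (contract (a_pow k * s)) + contract (dd (a_pow k * s)) - a_pow k * s \<in> filt (tdeg k - 1)"
proof -
  define j where "j = lead k"
  note j = lead_props[OF k(2), folded j_def]
  define e where "e = dd (a_pow k) - (\<Sum>i=1..n. symb k i)"
  have e: "contract (e * s) \<in> filt (tdeg k - 1)"
    unfolding e_def using s by (intro contract_filt filt_mult_seg dd_a_pow)
  have dd_eq: "dd (a_pow k * s) = e * s + (\<Sum>i=1..n. symb k i * s)"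
    using s by (simp add: e_def dd_mult dd_seg parity_a_pow algebra_simps sum_distrib_right)
  have 1: "contract (dd (a_pow k * s)) = contract (e * s) + (\<Sum>i=1..n. contract (symb k i * s))"
    unfolding dd_eq by (simp add: contract.add contract.sum)
  show ?thesis
  proof (cases "odd (k j)")
    case True
    have "contract_pow k = 0" using True by (simp add: contract_pow_def j_def)
    moreover have "(\<Sum>i=1..n. contract (symb k i * s)) = (\<Sum>i=1..n. if i = j then a_pow k * s else 0)"
      using True by (intro sum.cong) (simp_all add: contract_symb[OF k _ s] j_def[symmetric])
    ultimately show ?thesis using j(1) e
      by (simp add: contract_a_pow[OF k(1) s] 1)
  next
    case False
    define k' where "k' = k(j := k j - 1)"
    define t where "t = c j * s"
    have t: "t \<in> seg" using s j(1) unfolding t_def by (intro seg_intros)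
    define e' where "e' = dd (a_pow k') - (\<Sum>i=1..n. symb k' i)"
    have "tdeg k' \<le> tdeg k - 1" using tdeg_upd[OF j(1), of k "k j - 1"] j(2) unfolding k'_def by linarith
    then have e': "e' * t \<in> filt (tdeg k - 1)"
      unfolding e'_def using t by (intro filt_mult_seg filt_mono[OF _ dd_a_pow])
    have "contract (a_pow k * s) = sH (1/2) (a_pow k' * t)"
      using False k(2) by (simp add: contract_a_pow[OF k(1) s] contract_pow_def j_def[symmetric]
        k'_def t_def H.scale_mult_left[symmetric] mult.assoc)
    then have 2: "dd (contract (a_pow k * s)) = sH (1/2) (e' * t) + (\<Sum>i=1..n. sH (1/2) (symb k' i * t))"
      using t by (simp add: dd_scale dd_mult dd_seg parity_a_pow e'_def algebra_simps sum_distrib_right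
        H.scale_right_distrib H.scale_right_diff_distrib H.scale_sum_right)
    have "sH (1/2) (symb k' i * t) + contract (symb k i * s) = (if i = j then a_pow k * s else 0)"
      if i: "i \<in> {1..n}" for i
    proof (cases "i = j")
      case True
      have "odd (k j - 1)" using False j(2) by simp
      moreover have "k(j := Suc (k j - 1)) = k" using j(2) by auto
      ultimately show ?thesis using True False j(2) c_sq_left[OF j(1)]
        by (simp add: contract_symb[OF k i s] j_def[symmetric] symb_def k'_def t_def
            H.scale_mult_left[symmetric] half_scale mult.assoc)
    next
      case neq: False
      \<comment> \<open>The exponent changes at \<open>i\<close> and \<open>j\<close> commute, while
        \<open>c i\<close> and \<open>c j\<close> appear in opposite orders and anticommute.\<close>
      have "a_pow (k(j := k j - 1, i := Suc (k i))) * (c i * (c j * s))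
          + a_pow (k(i := Suc (k i), j := k j - 1)) * (c j * (c i * s)) = 0"
        using rel_c_c[OF i j(1) neq] neq by (simp add: fun_upd_twist mult.assoc[symmetric])
      from minus_unique[OF this] show ?thesis using neq False unfolding contract_symb[OF k i s]
        by (simp add: j_def[symmetric] symb_def k'_def t_def
            H.scale_mult_left[symmetric] half_scale mult.assoc eq_neg_iff_add_eq_0)
    qed
    then have "(\<Sum>i=1..n. sH (1/2) (symb k' i * t)) + (\<Sum>i=1..n. contract (symb k i * s)) = a_pow k * s"
      using j(1) by (simp add: sum.distrib[symmetric])
    then have "dd (contract (a_pow k * s)) + contract (dd (a_pow k * s)) - a_pow k * s
        = sH (1/2) (e' * t) + contract (e * s)"
      unfolding 1 2 by (simp add: algebra_simps)
    then show ?thesis using e e' by (simp only: filt_intros)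
  qed
qed

lemma contract_homotopy:
  assumes "m \<noteq> 0" "x \<in> filt m"
  shows "dd (contract x) + contract (dd x) - x \<in> filt (m - 1)"
  using assms(2) unfolding filt_eq_pow[of m]
proof (induction rule: H.span_induct_alt)
  case base
  then show ?case by (simp add: contract.zero filt_intros)
next
  case (step r x y)
  then obtain k s where x: "x = a_pow k * s" "k \<in> exps" "tdeg k \<le> m" "s \<in> seg" by blast
  have "dd (contract x) + contract (dd x) - x \<in> filt (m - 1)"
  proof (cases "tdeg k = 0")
    case True
    \<comment> \<open>In degree 0 both composites vanish, so the claim reduces to
      \<open>x \<in> filt (m - 1)\<close>, which holds as \<open>seg\<close> is the bottom of the
      filtration.\<close>
    then have "x \<in> seg" using a_pow_filt[of k 0 s] x by (simp add: filt_0)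
    then have "x \<in> filt (m - 1)" using filt_mono[of 0 "m - 1"] by (simp add: filt_0)
    then show ?thesis using \<open>x \<in> seg\<close> by (simp add: contract_seg dd_seg contract.zero filt_intros)
  next
    case False
    then show ?thesis using contract_homotopy_pow[OF x(2) False x(4)] x(1,3)
      by (auto intro: filt_mono[OF diff_le_mono])
  qed
  then have "sH r (dd (contract x) + contract (dd x) - x) + (dd (contract y) + contract (dd y) - y) \<in> filt (m - 1)"
    using step(2) by (rule filt_intros(2)[OF filt_intros(5)])
  then show ?case
    by (simp add: contract.add contract.scale dd_add dd_scale H.scale_right_distrib
        H.scale_right_diff_distrib algebra_simps)
qed

section \<open>The supercentralizer and averaging\<close>

text \<open>The condition is imposed on generators only;
  \<open>supercentralizer_supercommute\<close> extends it to \<open>seg\<close>.\<close>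

definition supercentralizer :: "'h set" where
  "supercentralizer =
    {h. (\<forall>i\<in>{1..n}. c i * h = H.parity h * c i) \<and> (\<forall>w\<in>W. f w * h = h * f w)}"

lemma double_cancel: "x + x = y + y \<Longrightarrow> x = (y :: 'h)"
  unfolding sH_2(1)[symmetric] H.scale_cancel_left by simp

lemma c_parity:
  assumes "i \<in> {1..n}" "c i * h = H.parity h * c i"
  shows "c i * H.parity h = h * c i"
  using arg_cong[OF assms(2), of H.parity] assms(1) by (simp add: H.parity_mult parity_c)

text \<open>Applying \<open>parity\<close> gives the relations for \<open>parity h\<close> too;
  adding isolates \<open>x\<close>, and subtracting the result from the relation for
  \<open>h\<close> isolates \<open>y\<close>.\<close>

lemma supercentralizer_homogeneous:
  assumes h: "h \<in> supercentralizer" and xy: "x \<in> H0" "y \<in> H1" "h = x + y"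
  shows "\<And>i. i \<in> {1..n} \<Longrightarrow> c i * x = x * c i" "\<And>i. i \<in> {1..n} \<Longrightarrow> c i * y = - (y * c i)"
    "\<And>w. w \<in> W \<Longrightarrow> f w * x = x * f w" "\<And>w. w \<in> W \<Longrightarrow> f w * y = y * f w"
proof -
  have p: "H.parity h = x - y" using xy by (simp add: H.parity_decomp)
  show cx: "c i * x = x * c i" if i: "i \<in> {1..n}" for i
  proof (rule double_cancel)
    have "c i * h = H.parity h * c i" using h i by (simp add: supercentralizer_def)
    then have "c i * (h + H.parity h) = (h + H.parity h) * c i"
      using c_parity[OF i] by (simp add: algebra_simps)
    then show "c i * x + c i * x = x * c i + x * c i"
      unfolding p unfolding xy(3) by (simp add: algebra_simps)
  qed
  show "c i * y = - (y * c i)" if i: "i \<in> {1..n}" for i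
  proof -
    have "c i * h = H.parity h * c i" using h i by (simp add: supercentralizer_def)
    then have "c i * y + y * c i = 0" unfolding p unfolding xy(3) using cx[OF i] by (simp add: algebra_simps)
    then show ?thesis by (simp add: eq_neg_iff_add_eq_0)
  qed
  show fx: "f w * x = x * f w" if w: "w \<in> W" for w
  proof (rule double_cancel)
    have 1: "f w * h = h * f w" using h w by (simp add: supercentralizer_def)
    have "f w * H.parity h = H.parity h * f w"
      using arg_cong[OF 1, of H.parity] w by (simp add: H.parity_mult parity_f)
    then have "f w * (h + H.parity h) = (h + H.parity h) * f w"
      using 1 by (simp add: algebra_simps)
    then show "f w * x + f w * x = x * f w + x * f w"
      unfolding p unfolding xy(3) by (simp add: algebra_simps)
  qed
  show "f w * y = y * f w" if w: "w \<in> W" for w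
  proof -
    have "f w * h = h * f w" using h w by (simp add: supercentralizer_def)
    then show ?thesis unfolding xy(3) using fx[OF w] by (simp add: algebra_simps)
  qed
qed

lemma supercentralizer_even:
  assumes "h \<in> supercentralizer" "h \<in> H0" "s \<in> seg"
  shows "s * h = h * s"
proof -
  note hom = supercentralizer_homogeneous[OF assms(1,2) H.subspace_0[OF H.subspace_odd], simplified]
  show ?thesis using assms(3)
  proof (induction rule: seg_induct)
    case (mult s t)
    then show ?case by (metis mult.assoc)
  qed (use hom in \<open>auto simp: algebra_simps H.scale_mult_left[symmetric] H.scale_mult_right[symmetric]\<close>)
qed

lemma supercentralizer_supercommute:
  assumes h: "h \<in> supercentralizer" and s: "s \<in> seg"
  shows "supercommute H0 H1 h s"
proof -
  obtain x y where xy: "x \<in> H0" "y \<in> H1" "h = x + y" "even_part H0 H1 h = x" "odd_part H0 H1 h = y"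
    by (rule H.homogeneous_cases)
  note hom = supercentralizer_homogeneous[OF h xy(1-3)]
  have "x * s = s * x \<and> y * s = H.parity s * y" using s
  proof (induction rule: seg_induct)
    case (mult s t)
    then show ?case unfolding H.parity_mult by (metis mult.assoc)
  qed (use hom in \<open>auto simp: parity_c parity_f H.parity_add H.parity_scale algebra_simps
      H.scale_mult_left[symmetric] H.scale_mult_right[symmetric]\<close>)
  then show ?thesis using xy by (intro H.supercommuteI) auto
qed

lemma supercentralizer_diff:
  "g \<in> supercentralizer \<Longrightarrow> h \<in> supercentralizer \<Longrightarrow> g - h \<in> supercentralizer"
  by (simp add: supercentralizer_def algebra_simps H.parity_diff)

lemma supercentralizer_add_parity:
  "h \<in> supercentralizer \<Longrightarrow> sH (1/2) (h + H.parity h) \<in> supercentralizer"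
proof -
  assume h: "h \<in> supercentralizer"
  have "f w * H.parity h = H.parity h * f w" if "w \<in> W" for w
  proof -
    have "f w * h = h * f w" using h that by (simp add: supercentralizer_def)
    from arg_cong[OF this, of H.parity] show ?thesis using that by (simp add: H.parity_mult parity_f)
  qed
  then show ?thesis using h c_parity
    by (simp add: supercentralizer_def H.parity_add H.parity_scale H.scale_mult_left[symmetric]
        H.scale_mult_right[symmetric] distrib_left distrib_right add.commute)
qed

lemma central_even_supercentralizer:
  assumes "z \<in> H0" "\<And>s. s \<in> seg \<Longrightarrow> z * s = s * z"
  shows "z \<in> supercentralizer"
  using assms seg_intros(2,3) by (simp add: supercentralizer_def H.parity_even)

lemma parity_filt: "x \<in> filt m \<Longrightarrow> H.parity x \<in> filt m"
  unfolding filt_def[of m]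
proof (induction rule: H.span_induct_alt)
  case (step r x y)
  then obtain l s where x: "x = a_word l * s" "set l \<subseteq> {1..n}" "length l \<le> m" "s \<in> seg" by blast
  have "a_word l * H.parity s \<in> filt m" using x by (intro filt_base parity_seg)
  then have "H.parity x \<in> filt m" by (simp add: x(1) H.parity_mult parity_a_word[OF x(2)])
  then show ?case using step(2) unfolding filt_def[symmetric] H.parity_add H.parity_scale
    by (rule filt_intros(2)[OF filt_intros(5)])
qed (simp add: H.span_zero)

text \<open>
  The supercentralizer consists of the invariants of a finite group acting on the algebra, and
  averaging over this group is compatible with the filtration and with \<open>dd\<close>. This allows
  corrections found by \<open>contract\<close> to be moved into the supercentralizer.
\<close>
definition averaging :: "('h \<Rightarrow> 'h) \<Rightarrow> bool" where
  "averaging P \<longleftrightarrow> (\<forall>x y. P (x - y) = P x - P y) \<and> (\<forall>x. P (dd x) = dd (P x)) \<and>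
     (\<forall>m. \<forall>x\<in>filt m. P x \<in> filt m) \<and> (\<forall>h\<in>supercentralizer. P h = h)"

lemma averaging_comp: "averaging P \<Longrightarrow> averaging Q \<Longrightarrow> averaging (P \<circ> Q)"
  by (auto simp: averaging_def)

text \<open>The mean of \<open>h\<close> and its image under conjugation by \<open>c i\<close>
  twisted by \<open>parity\<close>; the inverse of \<open>c i\<close> is \<open>- c i\<close>. This
  map is an involution whose fixed points supercommute with \<open>c i\<close>.\<close>

definition avg_c :: "nat \<Rightarrow> 'h \<Rightarrow> 'h" where
  "avg_c i h = sH (1/2) (h - c i * H.parity h * c i)"

lemma half_double: "sH (1/2) (x + x) = x"
  unfolding sH_2(1)[symmetric] by simp

lemma averaging_avg_c:
  assumes i: "i \<in> {1..n}"
  shows "averaging (avg_c i)"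
  unfolding averaging_def
proof (intro conjI allI ballI)
  show "avg_c i (x - y) = avg_c i x - avg_c i y" for x y
    by (simp add: avg_c_def H.parity_diff H.scale_right_diff_distrib left_diff_distrib
        right_diff_distrib)
  show "avg_c i (dd x) = dd (avg_c i x)" for x
  proof -
    \<comment> \<open>Twisted conjugation commutes with \<open>dd\<close> because \<open>c i\<close>
      and \<open>D\<close> anticommute.\<close>
    have "c i * H.parity (dd x) * c i = dirac * (c i * H.parity x * c i) - c i * x * c i * dirac"
    proof -
      have "c i * (dirac * u) = - (dirac * (c i * u))" for u
        using c_dirac[OF i] by (simp add: mult.assoc[symmetric])
      moreover have "dirac * c i = - (c i * dirac)" using c_dirac[OF i] by simp
      ultimately show ?thesis
        by (simp add: super_derivation_def H.parity_diff H.parity_mult parity_dirac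
            left_diff_distrib right_diff_distrib distrib_left distrib_right mult.assoc)
    qed
    also have "\<dots> = dd (c i * H.parity x * c i)"
      by (simp add: super_derivation_def H.parity_mult parity_c[OF i] mult.assoc)
    finally show ?thesis by (simp add: avg_c_def dd_scale dd_diff)
  qed
  show "avg_c i x \<in> filt m" if "x \<in> filt m" for x m
    unfolding avg_c_def using that i
    by (intro filt_intros filt_mult_seg seg_mult_filt parity_filt seg_intros)
  show "avg_c i h = h" if "h \<in> supercentralizer" for h
  proof -
    have "c i * h = H.parity h * c i" using that i by (simp add: supercentralizer_def)
    then have "c i * H.parity h * c i = - h"
      using c_sq_left[OF i] by (simp add: mult.assoc) (metis mult.assoc)
    then show ?thesis by (simp add: avg_c_def half_double)
  qed
qed

text \<open>The second part says that averaging with \<open>c i\<close> keeps what was achieved for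
  the other \<open>c j\<close>, so the averages can be applied in turn.\<close>

lemma avg_c_supercommute:
  assumes i: "i \<in> {1..n}"
  shows "c i * avg_c i h = H.parity (avg_c i h) * c i"
    and "j \<in> {1..n} \<Longrightarrow> j \<noteq> i \<Longrightarrow> c j * h = H.parity h * c j \<Longrightarrow>
      c j * avg_c i h = H.parity (avg_c i h) * c j"
proof -
  have p: "H.parity (avg_c i h) = sH (1/2) (H.parity h - c i * h * c i)"
    by (simp add: avg_c_def H.parity_scale H.parity_diff H.parity_mult parity_c[OF i])
  show "c i * avg_c i h = H.parity (avg_c i h) * c i"
    unfolding p unfolding avg_c_def using c_sq_left[OF i] c_sq[OF i]
    by (simp add: H.scale_mult_left[symmetric] H.scale_mult_right[symmetric] mult.assoc
        left_diff_distrib right_diff_distrib add.commute)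
  assume j: "j \<in> {1..n}" "j \<noteq> i" "c j * h = H.parity h * c j"
  have ji: "c j * c i = - (c i * c j)" using rel_c_c[OF j(1) i j(2)] .
  have "c j * (c i * H.parity h * c i) = - (c i * (c j * H.parity h) * c i)"
    using ji by (simp add: mult.assoc[symmetric])
  also have "\<dots> = - (c i * h * (c j * c i))" using c_parity[OF j(1,3)] by (simp add: mult.assoc)
  also have "\<dots> = c i * h * c i * c j" using ji by (simp add: mult.assoc)
  finally show "c j * avg_c i h = H.parity (avg_c i h) * c j"
    unfolding p unfolding avg_c_def using j(3)
    by (simp add: H.scale_mult_left[symmetric] H.scale_mult_right[symmetric]
        left_diff_distrib right_diff_distrib)
qed

definition avg_W :: "'h \<Rightarrow> 'h" where
  "avg_W h = sH (1 / of_nat (card W)) (\<Sum>w\<in>W. f w * h * f (inv w))"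

lemma averaging_avg_W: "averaging avg_W"
  unfolding averaging_def
proof (intro conjI allI ballI)
  show "avg_W (x - y) = avg_W x - avg_W y" for x y
    by (simp add: avg_W_def H.scale_right_diff_distrib left_diff_distrib right_diff_distrib
        sum_subtractf)
  show "avg_W (dd x) = dd (avg_W x)" for x
  proof -
    have "f w * dd x * f (inv w) = dd (f w * x * f (inv w))" if w: "w \<in> W" for w
      using w W_group(4)[OF w] dd_seg seg_intros(2)
      by (simp add: dd_mult parity_f H.parity_mult)
    moreover have "dd (\<Sum>w\<in>A. g w) = (\<Sum>w\<in>A. dd (g w))" for A and g :: "('e \<Rightarrow> 'e) \<Rightarrow> 'h"
      by (induction A rule: infinite_finite_induct) (auto simp: dd_add)
    ultimately show ?thesis by (simp add: avg_W_def dd_scale)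
  qed
  show "avg_W x \<in> filt m" if "x \<in> filt m" for x m
    unfolding avg_W_def using that W_group(4)
    by (intro filt_intros filt_mult_seg seg_mult_filt seg_intros)
  show "avg_W h = h" if "h \<in> supercentralizer" for h
  proof -
    have "f w * h * f (inv w) = h" if "w \<in> W" for w
      using that \<open>h \<in> supercentralizer\<close> by (simp add: supercentralizer_def mult.assoc f_inv)
    moreover have "card W \<noteq> 0" using W_group(1,2) by auto
    ultimately show ?thesis
      by (simp add: avg_W_def H.sum_constant_scale del: sum_constant)
  qed
qed

text \<open>Conjugation by \<open>w\<close> maps the span of all \<open>c j\<close> to itself, so
  supercommuting with every \<open>c j\<close> survives; commuting with \<open>W\<close> comes from
  translating the summation index.\<close>

lemma avg_W_supercentralizer:
  assumes h: "\<And>i. i \<in> {1..n} \<Longrightarrow> c i * h = H.parity h * c i"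
  shows "avg_W h \<in> supercentralizer"
  unfolding supercentralizer_def
proof (intro CollectI conjI ballI)
  fix i assume i: "i \<in> {1..n}"
  have "c i * (f w * h * f (inv w)) = f w * H.parity h * f (inv w) * c i" if w: "w \<in> W" for w
  proof -
    define u where "u = f (inv w) * c i * f w"
    have u: "u = (\<Sum>j=1..n. sH (rep_coeff (inv w) i j) (c j))"
      unfolding u_def using conj_c[OF W_group(4)[OF w] i] inv_inv_W[OF w] by simp
    have uh: "u * h = H.parity h * u"
      unfolding u H.sum_scale_mult H.mult_sum_scale using h by simp
    have "c i * (f w * h * f (inv w)) = f w * (u * h) * f (inv w)"
      by (simp add: u_def mult.assoc f_inv_cancel w)
    also have "\<dots> = f w * H.parity h * f (inv w) * c i"
      unfolding uh by (simp add: u_def mult.assoc f_inv w)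
    finally show ?thesis .
  qed
  moreover have "H.parity (avg_W h) = sH (1 / of_nat (card W)) (\<Sum>w\<in>W. f w * H.parity h * f (inv w))"
    using W_group(4) by (simp add: avg_W_def H.parity_scale H.parity_sum H.parity_mult parity_f)
  ultimately show "c i * avg_W h = H.parity (avg_W h) * c i"
    by (simp add: avg_W_def H.scale_mult_left[symmetric] H.scale_mult_right[symmetric]
        sum_distrib_left sum_distrib_right)
next
  fix v assume v: "v \<in> W"
  have "f v * (\<Sum>w\<in>W. f w * h * f (inv w)) = (\<Sum>w\<in>W. f (v \<circ> w) * h * f (inv (v \<circ> w))) * f v"
    unfolding sum_distrib_left sum_distrib_right
  proof (intro sum.cong refl)
    fix w assume w: "w \<in> W"
    have "f (inv (v \<circ> w)) = f (inv w) * f (inv v)"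
      using o_inv_distrib[OF W_group(5)[OF v] W_group(5)[OF w]] f_comp W_group(4) v w by simp
    then show "f v * (f w * h * f (inv w)) = f (v \<circ> w) * h * f (inv (v \<circ> w)) * f v"
      using v w by (simp add: f_comp mult.assoc f_inv)
  qed
  also have "(\<Sum>w\<in>W. f (v \<circ> w) * h * f (inv (v \<circ> w))) = (\<Sum>w\<in>W. f w * h * f (inv w))"
  proof (rule sum.reindex_bij_betw)
    have "inv v \<circ> (v \<circ> w) = w" "v \<circ> (inv v \<circ> w) = w" for w
      using W_group(5)[OF v] by (simp_all add: fun_eq_iff bij_is_inj bij_is_surj surj_f_inv_f)
    then show "bij_betw ((\<circ>) v) W W"
      using W_group(3,4) v by (intro bij_betw_byWitness[where f' = "(\<circ>) (inv v)"]) auto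
  qed
  finally show "f v * avg_W h = avg_W h * f v"
    by (simp add: avg_W_def H.scale_mult_left[symmetric] H.scale_mult_right[symmetric])
qed

text \<open>The \<open>c i\<close> are averaged one at a time and \<open>W\<close> last, since
  \<open>W\<close> preserves only the span of all the \<open>c i\<close>.\<close>

lemma averaging_exists: "\<exists>P. averaging P \<and> (\<forall>h. P h \<in> supercentralizer)"
proof -
  have "m \<le> n \<Longrightarrow> \<exists>P. averaging P \<and> (\<forall>h. \<forall>i\<in>{1..m}. c i * P h = H.parity (P h) * c i)" for m
  proof (induction m)
    case 0
    have "averaging id" by (simp add: averaging_def)
    then show ?case by auto
  next
    case (Suc m)
    then obtain P where P: "averaging P" "\<forall>h. \<forall>i\<in>{1..m}. c i * P h = H.parity (P h) * c i" by auto
    have m: "Suc m \<in> {1..n}" using Suc.prems by simp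
    have "c i * avg_c (Suc m) (P h) = H.parity (avg_c (Suc m) (P h)) * c i" if "i \<in> {1..Suc m}" for i h
      using avg_c_supercommute[OF m] P(2) that Suc.prems by (cases "i = Suc m") auto
    then show ?case using averaging_comp[OF averaging_avg_c[OF m] P(1)]
      by (intro exI[of _ "avg_c (Suc m) \<circ> P"]) (simp del: o_apply, simp)
  qed
  from this[of n] obtain P where P: "averaging P"
    "\<And>h i. i \<in> {1..n} \<Longrightarrow> c i * P h = H.parity (P h) * c i" by auto
  show ?thesis
    using averaging_comp[OF averaging_avg_W P(1)] avg_W_supercentralizer[OF P(2)]
    by (intro exI[of _ "avg_W \<circ> P"]) (simp add: o_def)
qed

text \<open>An averaging map fixes \<open>x\<close> and commutes with \<open>dd\<close>, so
  \<open>dd x\<close> lies in its image.\<close>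

lemma dd_supercentralizer:
  assumes "x \<in> supercentralizer"
  shows "dd x \<in> supercentralizer"
proof -
  obtain P where P: "averaging P" "\<And>h. P h \<in> supercentralizer" using averaging_exists by blast
  have "P (dd x) = dd x" using P(1) assms by (simp add: averaging_def)
  then show ?thesis using P(2) by metis
qed

section \<open>Cohomology of \<open>dd\<close> on the supercentralizer\<close>

context
  assumes dd_squared: "\<And>h. h \<in> supercentralizer \<Longrightarrow> dd (dd h) = 0"
begin

text \<open>For a cocycle the homotopy gives \<open>z = dd (contract z)\<close> up to lower degree.
  Averaging moves the correction into the supercentralizer, where \<open>dd_squared\<close> makes
  the remainder a cocycle again.\<close>

lemma cocycle_decomposition:
  assumes "z \<in> filt m" "z \<in> supercentralizer" "dd z = 0"
  shows "\<exists>s\<in>seg \<inter> supercentralizer. z - s \<in> range dd"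
  using assms
proof (induction m arbitrary: z)
  case 0
  have "z - z \<in> range dd" by (rule range_eqI[of _ _ 0]) simp
  then show ?case using 0 unfolding filt_0 by blast
next
  case (Suc m)
  obtain P where P: "averaging P" "\<And>h. P h \<in> supercentralizer" using averaging_exists by blast
  define y where "y = P (contract z)"
  have y: "y \<in> supercentralizer" unfolding y_def by (rule P(2))
  have "dd (contract z) - z \<in> filt m"
    using contract_homotopy[OF _ Suc.prems(1)] Suc.prems(3) by (simp add: contract_seg seg_intros)
  then have "z - dd (contract z) \<in> filt m" using filt_intros(4) by (metis minus_diff_eq)
  moreover have "P (z - dd (contract z)) = z - dd y"
    using P(1) Suc.prems(2) by (simp add: averaging_def y_def)
  ultimately have "z - dd y \<in> filt m" using P(1) unfolding averaging_def by metis
  then obtain s x where s: "s \<in> seg \<inter> supercentralizer" "z - dd y - s = dd x"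
    using Suc.IH[of "z - dd y"] Suc.prems(2,3) supercentralizer_diff dd_supercentralizer[OF y]
      dd_squared[OF y] dd_diff by auto
  then have "z - s = dd (x + y)" by (simp add: dd_add algebra_simps)
  then show ?case using s(1) by blast
qed

text \<open>\<open>contract\<close> vanishes on \<open>dd y\<close>, so subtracting a coboundary
  lowers the degree of \<open>y\<close> without changing \<open>dd y\<close>, down to
  \<open>y \<in> seg\<close>.\<close>

lemma dd_in_seg_zero_aux:
  assumes "y \<in> filt m" "y \<in> supercentralizer" "dd y \<in> seg"
  shows "dd y = 0"
  using assms
proof (induction m arbitrary: y)
  case 0
  then show ?case by (simp add: filt_0 dd_seg)
next
  case (Suc m)
  obtain P where P: "averaging P" "\<And>h. P h \<in> supercentralizer" using averaging_exists by blast
  define x where "x = P (contract y)"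
  have x: "x \<in> supercentralizer" unfolding x_def by (rule P(2))
  have "dd (contract y) - y \<in> filt m"
    using contract_homotopy[OF _ Suc.prems(1)] Suc.prems(3) by (simp add: contract_seg)
  then have "y - dd (contract y) \<in> filt m" using filt_intros(4) by (metis minus_diff_eq)
  moreover have "P (y - dd (contract y)) = y - dd x"
    using P(1) Suc.prems(2) by (simp add: averaging_def x_def)
  ultimately have "y - dd x \<in> filt m" using P(1) unfolding averaging_def by metis
  moreover have "dd (y - dd x) = dd y" using dd_squared[OF x] by (simp add: dd_diff)
  ultimately show ?case
    using Suc.IH[of "y - dd x"] Suc.prems supercentralizer_diff dd_supercentralizer[OF x] by simp
qed

lemma dd_in_seg_zero:
  assumes "s \<in> seg" "s \<in> supercentralizer" "s \<in> range dd"
  shows "s = 0"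
proof -
  obtain P where P: "averaging P" "\<And>h. P h \<in> supercentralizer" using averaging_exists by blast
  obtain y where y: "s = dd y" using assms(3) by blast
  \<comment> \<open>Averaging fixes \<open>s\<close> and replaces its primitive by one in the
    supercentralizer.\<close>
  have "s = dd (P y)" using P(1) assms(2) y by (metis averaging_def)
  then show ?thesis using dd_in_seg_zero_aux[of "P y"] filt_exhaust[of "P y"] P(2) assms(1) by metis
qed

text \<open>A representative in \<open>seg\<close> may be replaced by its even part because
  \<open>range dd\<close> is stable under \<open>parity\<close>. Even elements of the
  supercentralizer commute with \<open>seg\<close>, and two representatives differ by a coboundary
  in \<open>seg\<close>, which is 0.\<close>

lemma even_cocycle_decomposition:
  assumes z: "z \<in> supercentralizer" "dd z = 0" "z \<in> H0"
  shows "\<exists>!s. s \<in> alg_center seg \<inter> H0 \<and> z - s \<in> range dd"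
proof (rule ex_ex1I)
  obtain m where "z \<in> filt m" using filt_exhaust by blast
  then obtain s x where s: "s \<in> seg" "s \<in> supercentralizer" "z - s = dd x"
    using cocycle_decomposition z by blast
  define t where "t = sH (1/2) (s + H.parity s)"
  have t: "t \<in> seg" "t \<in> supercentralizer" "t \<in> H0"
    unfolding t_def using s supercentralizer_add_parity
    by (auto intro: seg_intros parity_seg simp: H.even_iff H.parity_scale H.parity_add add.commute)
  have "z - H.parity s = - dd (H.parity x)"
    using arg_cong[OF s(3), of H.parity] z(3) by (simp add: H.parity_diff H.parity_even parity_dd)
  then have "(z - s) + (z - H.parity s) = dd (x - H.parity x)" using s(3) by (simp add: dd_diff)
  moreover have "z - t = sH (1/2) ((z - s) + (z - H.parity s))"
    using half_double[of z] unfolding t_def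
    by (simp add: H.scale_right_distrib H.scale_right_diff_distrib algebra_simps)
  ultimately have "z - t = dd (sH (1/2) (x - H.parity x))" by (simp add: dd_scale)
  then show "\<exists>t. t \<in> alg_center seg \<inter> H0 \<and> z - t \<in> range dd"
    using t supercentralizer_even[OF t(2,3)] by (auto simp: alg_center_def)
next
  fix s t assume st: "s \<in> alg_center seg \<inter> H0 \<and> z - s \<in> range dd"
    "t \<in> alg_center seg \<inter> H0 \<and> z - t \<in> range dd"
  then obtain x y where "z - s = dd x" "z - t = dd y" by blast
  then have "s - t = dd (y - x)" by (simp add: dd_diff algebra_simps)
  moreover have "s \<in> supercentralizer" "t \<in> supercentralizer"
    using st by (auto simp: alg_center_def intro!: central_even_supercentralizer)
  ultimately have "s - t = 0"
    using st by (intro dd_in_seg_zero supercentralizer_diff seg_intros) (auto simp: alg_center_def)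
  then show "s = t" by simp
qed

end

section \<open>The homomorphism zeta on even central elements\<close>

lemma dd_even_central:
  assumes "z \<in> alg_center UNIV \<inter> H0"
  shows "dd z = 0" "z \<in> supercentralizer"
  using assms central_even_supercentralizer
  by (auto simp: alg_center_def super_derivation_def H.parity_even)

lemma even_center_intros:
  assumes B: "H.subspace B" "1 \<in> B" "\<And>x y. x \<in> B \<Longrightarrow> y \<in> B \<Longrightarrow> x * y \<in> B"
  shows "1 \<in> alg_center B \<inter> H0"
    "x \<in> alg_center B \<inter> H0 \<Longrightarrow> y \<in> alg_center B \<inter> H0 \<Longrightarrow> x + y \<in> alg_center B \<inter> H0"
    "x \<in> alg_center B \<inter> H0 \<Longrightarrow> y \<in> alg_center B \<inter> H0 \<Longrightarrow> x * y \<in> alg_center B \<inter> H0"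
    "x \<in> alg_center B \<inter> H0 \<Longrightarrow> sH r x \<in> alg_center B \<inter> H0"
proof -
  show "1 \<in> alg_center B \<inter> H0" using B(2) by (simp add: alg_center_def H.even_iff)
  assume x: "x \<in> alg_center B \<inter> H0"
  then show "sH r x \<in> alg_center B \<inter> H0"
    using H.subspace_scale[OF B(1)] H.subspace_scale[OF H.subspace_even]
    by (auto simp: alg_center_def H.scale_mult_left[symmetric] H.scale_mult_right[symmetric])
  assume y: "y \<in> alg_center B \<inter> H0"
  show "x + y \<in> alg_center B \<inter> H0"
    using x y H.subspace_add[OF B(1)] H.subspace_add[OF H.subspace_even]
    by (auto simp: alg_center_def distrib_left distrib_right)
  have "(x * y) * b = b * (x * y)" if "b \<in> B" for b
  proof -
    have xb: "x * b = b * x" and yb: "y * b = b * y"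
      using x y that by (auto simp: alg_center_def)
    have "(x * y) * b = x * b * y" by (simp only: mult.assoc yb)
    also have "\<dots> = b * (x * y)" unfolding xb by (rule mult.assoc)
    finally show ?thesis .
  qed
  then show "x * y \<in> alg_center B \<inter> H0"
    using x y B(3) H.even_even unfolding alg_center_def by blast
qed

text \<open>By uniqueness, each identity only requires that the proposed value be a
  representative.\<close>

lemma representative_alg_hom:
  defines "ZH \<equiv> alg_center UNIV \<inter> H0" and "ZS \<equiv> alg_center seg \<inter> H0"
  assumes ex1: "\<And>z. z \<in> ZH \<Longrightarrow> \<exists>!s. s \<in> ZS \<and> z - s \<in> range dd"
  shows "alg_hom_on sH ZH ZS (\<lambda>z. THE s. s \<in> ZS \<and> z - s \<in> range dd)"
proof -
  define \<zeta> where "\<zeta> z = (THE s. s \<in> ZS \<and> z - s \<in> range dd)" for z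
  have \<zeta>: "\<zeta> z \<in> ZS" "z - \<zeta> z \<in> range dd" if "z \<in> ZH" for z
    using theI'[OF ex1[OF that]] by (simp_all add: \<zeta>_def)
  have eq: "\<zeta> z = s" if "z \<in> ZH" "s \<in> ZS" "z - s = dd x" for z s x
    unfolding \<zeta>_def using that by (intro the1_equality[OF ex1]) auto
  note ZH = even_center_intros[of UNIV, folded ZH_def, OF H.subspace_UNIV, simplified]
  note ZS = even_center_intros[of seg, folded ZS_def, OF subspace_seg seg_intros(1,4), simplified]
  have "\<zeta> (x + y) = \<zeta> x + \<zeta> y" if xy: "x \<in> ZH" "y \<in> ZH" for x y
  proof -
    obtain u v where "x - \<zeta> x = dd u" "y - \<zeta> y = dd v" using \<zeta>(2) xy by blast
    then have "x + y - (\<zeta> x + \<zeta> y) = dd (u + v)" unfolding dd_add by (metis add_diff_add)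
    then show ?thesis using xy \<zeta>(1) ZH ZS by (intro eq) simp_all
  qed
  moreover have "\<zeta> (sH r x) = sH r (\<zeta> x)" if x: "x \<in> ZH" for r x
  proof -
    obtain u where "x - \<zeta> x = dd u" using \<zeta>(2) x by blast
    then have "sH r x - sH r (\<zeta> x) = dd (sH r u)" by (simp add: dd_scale H.scale_right_diff_distrib[symmetric])
    then show ?thesis using x \<zeta>(1) ZH ZS by (intro eq) simp_all
  qed
  moreover have "\<zeta> (x * y) = \<zeta> x * \<zeta> y" if xy: "x \<in> ZH" "y \<in> ZH" for x y
  proof -
    obtain u v where uv: "x - \<zeta> x = dd u" "y - \<zeta> y = dd v" using \<zeta>(2) xy by blast
    have "dd x = 0" "H.parity x = x" using xy dd_even_central(1) by (auto simp: ZH_def H.parity_even)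
    moreover have "dd (\<zeta> y) = 0" using \<zeta>(1)[OF xy(2)] by (simp add: ZS_def alg_center_def dd_seg)
    \<comment> \<open>The primitive comes from \<open>x * y - \<zeta> x * \<zeta> y = x * (y -
      \<zeta> y) + (x - \<zeta> x) * \<zeta> y\<close>, with \<open>x\<close> an even cocycle and
      \<open>\<zeta> y\<close> a cocycle.\<close>
    ultimately have "dd (x * v + u * \<zeta> y) = x * dd v + dd u * \<zeta> y"
      by (simp add: dd_add dd_mult)
    also have "\<dots> = x * y - \<zeta> x * \<zeta> y" unfolding uv[symmetric] by (simp add: algebra_simps)
    finally show ?thesis using xy \<zeta>(1) ZH ZS by (intro eq[OF _ _ sym]) simp_all
  qed
  moreover have "\<zeta> 1 = 1" by (rule eq[where x = 0]) (simp_all add: ZH ZS)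
  ultimately show ?thesis using \<zeta>(1) unfolding alg_hom_on_def \<zeta>_def[symmetric] by blast
qed

end

theorem theorem3p4:
  fixes W :: "('e::euclidean_space \<Rightarrow> 'e) set"
    and sV :: "complex \<Rightarrow> 'v::ab_group_add \<Rightarrow> 'v"
    and \<rho> :: "('e \<Rightarrow> 'e) \<Rightarrow> 'v \<Rightarrow> 'v"
    and ip :: "'v \<Rightarrow> 'v \<Rightarrow> complex"
    and sH :: "complex \<Rightarrow> 'h::ring_1 \<Rightarrow> 'h"
    and H0 H1 S ZH ZS :: "'h set"
    and n :: nat
    and bs :: "nat \<Rightarrow> 'v"
    and f :: "('e \<Rightarrow> 'e) \<Rightarrow> 'h"
    and c a :: "nat \<Rightarrow> 'h"
    and D :: 'h
    and d :: "'h \<Rightarrow> 'h"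
  assumes star: "hecke_clifford W sV \<rho> ip sH H0 H1 n bs f c a"
    and S: "S = Seg sH W n f c"
    and D: "D = dirac_element n c a"
    and d: "d = dirac_derivation H0 H1 D"
    and ZH: "ZH = alg_center UNIV \<inter> H0"
    and ZS: "ZS = alg_center S \<inter> H0"
    and starstar: "\<And>h. (\<forall>s\<in>S. supercommute H0 H1 h s) \<Longrightarrow> D\<^sup>2 * h - h * D\<^sup>2 = 0"
  shows "(\<forall>z\<in>ZH. \<exists>!zt. zt \<in> ZS \<and> z - zt \<in> range d) \<and>
         alg_hom_on sH ZH ZS (\<lambda>z. THE zt. zt \<in> ZS \<and> z - zt \<in> range d)"
proof -
  interpret hecke_clifford W sV \<rho> ip sH H0 H1 n bs f c a by (rule star)
  have d_eq: "d = super_derivation H.parity D" unfolding d by (rule H.dirac_derivation_eq)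
  \<comment> \<open>By \<open>dd_dd\<close> this is \<open>starstar\<close>, applied to an element
    that supercommutes with all of \<open>S\<close>.\<close>
  have dd_squared: "dd (dd h) = 0" if "h \<in> supercentralizer" for h
    using starstar[of h] supercentralizer_supercommute[OF that] unfolding dd_dd S D by blast
  have ex1: "\<exists>!s. s \<in> ZS \<and> z - s \<in> range d" if "z \<in> ZH" for z
    using even_cocycle_decomposition[OF dd_squared] dd_even_central[of z] that
    unfolding ZH ZS S d_eq D by blast
  then show ?thesis
    using representative_alg_hom unfolding ZH ZS S d_eq D by blast
qed

end
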